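(* Let $d\in\{1,2,3\}$, $T>0$, and let $\mathbb{T}^d$ be the $d$-dimensional torus. Consider the stochastic Schr\"odinger equation $\mathrm{i}\,\mathrm{d}u=\Delta u\,\mathrm{d}t+V(x)u\,\mathrm{d}t+\mathrm{d}W$ on $\mathbb{T}^d\times(0,\infty)$, $u(\cdot,0)=u_0$, where $V$ is a real-valued potential, $u_0$ is $\mathcal{F}_0$-measurable and $W$ is a $Q$-Wiener process. For an integer $N\ge1$ let $k=T/N$, $t_n=nk$, and let $u^n$ be the stochastic exponential integrator defined by $u^0=u_0$ and $$u^n=S(k)u^{n-1}-\mathrm{i}kS(k)Vu^{n-1}-\mathrm{i}S(k)\bigl(W(t_n)-W(t_{n-1})\bigr),\qquad n\ge1.$$ Let $M(u)=\int_{\mathbb{T}^d}|u|^2\,\mathrm{d}x$. Assume that $\mathbb{E}[M(u_0)]$ is finite, that $V\in H^2$, and that $Q$ is trace-class. Then $$\mathbb{E}[M(u^n)]=\mathbb{E}[M(u_0)]+t_n\,\mathrm{Tr}(Q)+\mathcal{O}(k)\qquad\text{for }0\le t_n=nk\le T,$$ that is, there is a constant $C$, independent of $k$ and $n$, such that $\bigl|\mathbb{E}[M(u^n)]-\mathbb{E}[M(u_0)]-t_n\mathrm{Tr}(Q)\bigr|\le Ck$ for all $n$ with $0\le nk\le T$.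
   Context: $L^2=L^2(\mathbb{T}^d)$ is the space of complex-valued square integrable functions on the torus, with inner product $(u,v)=\mathrm{Re}\int_{\mathbb{T}^d}u\bar v\,\mathrm{d}x$; $H^2=H^2(\mathbb{T}^d)$ is the Sobolev space of order 2. $S(t)=\mathrm{e}^{-\mathrm{i}t\Delta}$ is the unitary group generated by $-\mathrm{i}\Delta$. $(\Omega,\mathcal{F},\mathbb{P},\{\mathcal{F}_t\}_{t\ge0})$ is a filtered probability space with a normal filtration; $Q$ is a nonnegative self-adjoint operator on $L^2$, and $W$ is a complex-valued (i.e. $L^2$-valued), square integrable $Q$-Wiener process with respect to $\{\mathcal{F}_t\}$, so $W(t)=\sum_j\beta_j(t)Q^{1/2}e_j$ for an orthonormal basis $(e_j)$ of $L^2$ and independent standard real Brownian motions $\beta_j$. $\mathrm{Tr}(Q)=\sum_j\|Q^{1/2}e_j\|_{L^2}^2$. *)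

theory Defs
  imports "HOL-Probability.Probability"
begin

section \<open>The complex Lebesgue space on the torus\<close>

text \<open>
  The torus is \<open>(\<real> / 2\<pi>\<int>)\<^sup>d\<close> with \<open>d = CARD('d)\<close>. A function on it is represented by its values on
  the fundamental cell \<open>[0, 2\<pi>)\<^sup>d\<close>, which carries Lebesgue measure.
\<close>

definition torus :: "(real ^ 'd::finite) measure" where
  "torus = restrict_space lborel {x. \<forall>i. 0 \<le> x $ i \<and> x $ i < 2 * pi}"

lemma measurable_cnj [measurable]: "cnj \<in> borel_measurable borel"
  by (intro borel_measurable_continuous_onI continuous_intros)

definition square_integrable :: "(real ^ 'd::finite \<Rightarrow> complex) \<Rightarrow> bool" where
  "square_integrable f \<longleftrightarrow>
     f \<in> borel_measurable torus \<and> integrable torus (\<lambda>x. (norm (f x))\<^sup>2)"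

lemma square_integrable_measurable [measurable_dest]:
  "square_integrable f \<Longrightarrow> f \<in> borel_measurable torus"
  by (simp add: square_integrable_def)

lemma square_integrable_zero: "square_integrable (\<lambda>x. 0)"
  by (simp add: square_integrable_def)

lemma square_integrable_add:
  assumes "square_integrable f" "square_integrable g"
  shows "square_integrable (\<lambda>x. f x + g x)"
proof -
  note [measurable] = assms[THEN square_integrable_measurable]
  have "integrable torus (\<lambda>x. (norm (f x + g x))\<^sup>2)"
  proof (rule Bochner_Integration.integrable_bound)
    show "integrable torus (\<lambda>x. 2 * (norm (f x))\<^sup>2 + 2 * (norm (g x))\<^sup>2)"
      using assms by (simp add: square_integrable_def)
    have "(norm (a + b))\<^sup>2 \<le> 2 * (norm a)\<^sup>2 + 2 * (norm b)\<^sup>2" for a b :: complex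
    proof -
      have "(norm (a + b))\<^sup>2 \<le> (norm a + norm b)\<^sup>2"
        by (simp add: norm_triangle_ineq power_mono)
      also have "\<dots> \<le> 2 * (norm a)\<^sup>2 + 2 * (norm b)\<^sup>2"
        using sum_squares_bound[of "norm a" "norm b"] by (simp add: power2_sum)
      finally show ?thesis .
    qed
    then show "AE x in torus. norm ((norm (f x + g x))\<^sup>2)
        \<le> norm (2 * (norm (f x))\<^sup>2 + 2 * (norm (g x))\<^sup>2)"
      by simp
  qed measurable
  then show ?thesis
    by (simp add: square_integrable_def)
qed

lemma square_integrable_scale:
  assumes "square_integrable f"
  shows "square_integrable (\<lambda>x. c * f x)"
proof -
  note [measurable] = assms[THEN square_integrable_measurable]
  have "(\<lambda>x. c * f x) \<in> borel_measurable torus"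
    by measurable
  then show ?thesis
    using assms by (simp add: square_integrable_def norm_mult power_mult_distrib)
qed

lemma square_integrable_uminus:
  "square_integrable f \<Longrightarrow> square_integrable (\<lambda>x. - f x)"
  by (simp add: square_integrable_def)

lemma square_integrable_diff:
  assumes "square_integrable f" "square_integrable g"
  shows "square_integrable (\<lambda>x. f x - g x)"
  using square_integrable_add[OF assms(1) square_integrable_uminus[OF assms(2)]] by simp

lemma square_integrable_scaleR:
  assumes "square_integrable f"
  shows "square_integrable (\<lambda>x. r *\<^sub>R f x)"
  using square_integrable_scale[OF assms, of "of_real r"] by (simp add: scaleR_conv_of_real)

lemma square_integrable_mult:
  assumes "square_integrable f" "square_integrable g"
  shows "integrable torus (\<lambda>x. f x * cnj (g x))"
proof -
  note [measurable] = assms[THEN square_integrable_measurable]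
  show ?thesis
  proof (rule Bochner_Integration.integrable_bound)
    show "integrable torus (\<lambda>x. (norm (f x))\<^sup>2 + (norm (g x))\<^sup>2)"
      using assms by (simp add: square_integrable_def)
    have "norm (a * cnj b) \<le> (norm a)\<^sup>2 + (norm b)\<^sup>2" for a b :: complex
    proof -
      have "0 \<le> norm a * norm b"
        by simp
      then show ?thesis
        using sum_squares_bound[of "norm a" "norm b"]
        unfolding norm_mult complex_mod_cnj by linarith
    qed
    then show "AE x in torus. norm (f x * cnj (g x)) \<le> norm ((norm (f x))\<^sup>2 + (norm (g x))\<^sup>2)"
      by simp
  qed measurable
qed

definition ae_equal :: "(real ^ 'd::finite \<Rightarrow> complex) \<Rightarrow> (real ^ 'd \<Rightarrow> complex) \<Rightarrow> bool" where
  "ae_equal f g \<longleftrightarrow>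
     square_integrable f \<and> square_integrable g \<and> (AE x in torus. f x = g x)"

quotient_type (overloaded) 'd L2 = "real ^ ('d::finite) \<Rightarrow> complex" / partial: ae_equal
proof (rule part_equivpI)
  show "\<exists>f :: real ^ 'd \<Rightarrow> complex. ae_equal f f"
    by (rule exI[of _ "\<lambda>x. 0"]) (simp add: ae_equal_def square_integrable_zero)
  show "symp (ae_equal :: (real ^ 'd \<Rightarrow> complex) \<Rightarrow> _)"
    by (rule sympI) (auto simp: ae_equal_def elim: eventually_mono)
  show "transp (ae_equal :: (real ^ 'd \<Rightarrow> complex) \<Rightarrow> _)"
    by (rule transpI) (auto simp: ae_equal_def elim: eventually_elim2)
qed

text \<open>The space is regarded as a real Hilbert space with \<open>(u, v) = Re \<integral> u v\<^sup>*\<close>.\<close>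

instantiation L2 :: (finite) real_vector
begin

lift_definition zero_L2 :: "'a L2" is "\<lambda>x. 0"
  by (simp add: ae_equal_def square_integrable_zero)

lift_definition plus_L2 :: "'a L2 \<Rightarrow> 'a L2 \<Rightarrow> 'a L2" is "\<lambda>f g x. f x + g x"
  by (auto simp: ae_equal_def square_integrable_add elim: eventually_elim2)

lift_definition uminus_L2 :: "'a L2 \<Rightarrow> 'a L2" is "\<lambda>f x. - f x"
  by (auto simp: ae_equal_def square_integrable_uminus elim: eventually_mono)

lift_definition minus_L2 :: "'a L2 \<Rightarrow> 'a L2 \<Rightarrow> 'a L2" is "\<lambda>f g x. f x - g x"
  by (auto simp: ae_equal_def square_integrable_diff elim: eventually_elim2)

lift_definition scaleR_L2 :: "real \<Rightarrow> 'a L2 \<Rightarrow> 'a L2" is "\<lambda>r f x. r *\<^sub>R f x"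
  by (auto simp: ae_equal_def square_integrable_scaleR elim: eventually_mono)

instance
proof
  fix u v w :: "'a L2" and r s :: real
  show "u + v + w = u + (v + w)"
    by transfer (auto simp: ae_equal_def square_integrable_add algebra_simps)
  show "u + v = v + u"
    by transfer (auto simp: ae_equal_def square_integrable_add algebra_simps)
  show "0 + u = u"
    by transfer (auto simp: ae_equal_def)
  show "- u + u = 0"
    by transfer (auto simp: ae_equal_def square_integrable_zero)
  show "u - v = u + - v"
    by transfer (auto simp: ae_equal_def square_integrable_diff)
  show "r *\<^sub>R (u + v) = r *\<^sub>R u + r *\<^sub>R v"
    by transfer (auto simp: ae_equal_def square_integrable_add square_integrable_scaleR
        scaleR_add_right)
  show "(r + s) *\<^sub>R u = r *\<^sub>R u + s *\<^sub>R u"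
    by transfer (auto simp: ae_equal_def square_integrable_add square_integrable_scaleR
        scaleR_add_left)
  show "r *\<^sub>R s *\<^sub>R u = (r * s) *\<^sub>R u"
    by transfer (auto simp: ae_equal_def square_integrable_scaleR)
  show "1 *\<^sub>R u = u"
    by transfer (auto simp: ae_equal_def)
qed

end

instantiation L2 :: (finite) real_inner
begin

lift_definition inner_L2 :: "'a L2 \<Rightarrow> 'a L2 \<Rightarrow> real" is
  "\<lambda>f g. Re (\<integral>x. f x * cnj (g x) \<partial>torus)"
proof -
  fix f f' g g' :: "real ^ 'a \<Rightarrow> complex"
  assume *: "ae_equal f f'" "ae_equal g g'"
  then have [measurable]: "f \<in> borel_measurable torus" "f' \<in> borel_measurable torus"
      "g \<in> borel_measurable torus" "g' \<in> borel_measurable torus"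
    by (simp_all add: ae_equal_def square_integrable_def)
  have "AE x in torus. f x = f' x" "AE x in torus. g x = g' x"
    using * by (simp_all add: ae_equal_def)
  then have "AE x in torus. f x * cnj (g x) = f' x * cnj (g' x)"
    by eventually_elim simp
  then have "(\<integral>x. f x * cnj (g x) \<partial>torus) = (\<integral>x. f' x * cnj (g' x) \<partial>torus)"
    by (rule integral_cong_AE[rotated 2]) measurable
  then show "Re (\<integral>x. f x * cnj (g x) \<partial>torus) = Re (\<integral>x. f' x * cnj (g' x) \<partial>torus)"
    by simp
qed

definition norm_L2 :: "'a L2 \<Rightarrow> real" where "norm_L2 u = sqrt (inner u u)"
definition dist_L2 :: "'a L2 \<Rightarrow> 'a L2 \<Rightarrow> real" where "dist_L2 u v = norm (u - v)"
definition sgn_L2 :: "'a L2 \<Rightarrow> 'a L2" where "sgn_L2 u = u /\<^sub>R norm u"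
definition uniformity_L2 :: "('a L2 \<times> 'a L2) filter" where
  "uniformity_L2 = (INF e\<in>{0<..}. principal {(u, v). dist u v < e})"
definition open_L2 :: "'a L2 set \<Rightarrow> bool" where
  "open_L2 U \<longleftrightarrow> (\<forall>u\<in>U. eventually (\<lambda>(u', v). u' = u \<longrightarrow> v \<in> U) uniformity)"

instance
proof
  fix u v w :: "'a L2" and r :: real
  show "dist u v = norm (u - v)"
    by (rule dist_L2_def)
  show "sgn u = u /\<^sub>R norm u"
    by (rule sgn_L2_def)
  show "uniformity = (INF e\<in>{0<..}. principal {(u :: 'a L2, v). dist u v < e})"
    by (rule uniformity_L2_def)
  show "open U \<longleftrightarrow> (\<forall>u\<in>U. eventually (\<lambda>(u', v). u' = u \<longrightarrow> v \<in> U) uniformity)"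
    for U :: "'a L2 set"
    by (rule open_L2_def)
  show "norm u = sqrt (inner u u)"
    by (rule norm_L2_def)
  show "inner u v = inner v u"
  proof transfer
    fix f g :: "real ^ 'a \<Rightarrow> complex"
    have "(\<integral>x. g x * cnj (f x) \<partial>torus) = (\<integral>x. cnj (f x * cnj (g x)) \<partial>torus)"
      by (simp add: mult.commute)
    also have "\<dots> = cnj (\<integral>x. f x * cnj (g x) \<partial>torus)"
      by (rule Bochner_Integration.integral_cnj)
    finally show "Re (\<integral>x. f x * cnj (g x) \<partial>torus) = Re (\<integral>x. g x * cnj (f x) \<partial>torus)"
      by simp
  qed
  show "inner (u + v) w = inner u w + inner v w"
  proof transfer
    fix f g h :: "real ^ 'a \<Rightarrow> complex"
    assume "ae_equal f f" "ae_equal g g" "ae_equal h h"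
    then have "integrable torus (\<lambda>x. f x * cnj (h x))" "integrable torus (\<lambda>x. g x * cnj (h x))"
      by (simp_all add: ae_equal_def square_integrable_mult)
    then show "Re (\<integral>x. (f x + g x) * cnj (h x) \<partial>torus)
        = Re (\<integral>x. f x * cnj (h x) \<partial>torus) + Re (\<integral>x. g x * cnj (h x) \<partial>torus)"
      by (simp add: distrib_right)
  qed
  show "inner (r *\<^sub>R u) v = r * inner u v"
    by transfer (simp add: scaleR_conv_of_real mult.assoc)
  have sq: "Re (\<integral>x. f x * cnj (f x) \<partial>torus) = (\<integral>x. (norm (f x))\<^sup>2 \<partial>torus)"
    for f :: "real ^ 'a \<Rightarrow> complex"
  proof -
    have "(\<integral>x. f x * cnj (f x) \<partial>torus) = (\<integral>x. complex_of_real ((norm (f x))\<^sup>2) \<partial>torus)"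
      by (simp only: complex_norm_square)
    then show ?thesis
      by (simp only: integral_complex_of_real Re_complex_of_real)
  qed
  show "0 \<le> inner u u"
    by transfer (simp add: sq)
  show "inner u u = 0 \<longleftrightarrow> u = 0"
  proof transfer
    fix f :: "real ^ 'a \<Rightarrow> complex"
    assume f: "ae_equal f f"
    then have "integrable torus (\<lambda>x. (norm (f x))\<^sup>2)"
      by (simp add: ae_equal_def square_integrable_def)
    then have "(\<integral>x. (norm (f x))\<^sup>2 \<partial>torus) = 0 \<longleftrightarrow> (AE x in torus. (norm (f x))\<^sup>2 = 0)"
      by (intro integral_nonneg_eq_0_iff_AE) auto
    then show "Re (\<integral>x. f x * cnj (f x) \<partial>torus) = 0 \<longleftrightarrow> ae_equal f (\<lambda>x. 0)"
      using f by (simp add: sq ae_equal_def square_integrable_zero)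
  qed
qed

end

lift_definition scaleC_L2 :: "complex \<Rightarrow> 'd::finite L2 \<Rightarrow> 'd L2" (infixr \<open>*\<^sub>C\<close> 75) is
  "\<lambda>c f x. c * f x"
  by (auto simp: ae_equal_def square_integrable_scale elim: eventually_mono)

text \<open>
  Pointwise product, set to \<open>0\<close> when the product is not square integrable. For \<open>V\<close> in the Sobolev
  space of order two and \<open>d \<le> 3\<close> that case does not occur, as \<open>V\<close> is then essentially bounded.
\<close>

lift_definition mult_L2 :: "'d::finite L2 \<Rightarrow> 'd L2 \<Rightarrow> 'd L2" is
  "\<lambda>f g. if square_integrable (\<lambda>x. f x * g x) then (\<lambda>x. f x * g x) else (\<lambda>x. 0)"
proof -
  fix f f' g g' :: "real ^ 'd \<Rightarrow> complex"
  assume *: "ae_equal f f'" "ae_equal g g'"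
  then have [measurable]: "f \<in> borel_measurable torus" "f' \<in> borel_measurable torus"
      "g \<in> borel_measurable torus" "g' \<in> borel_measurable torus"
    by (simp_all add: ae_equal_def square_integrable_def)
  have "AE x in torus. f x = f' x" "AE x in torus. g x = g' x"
    using * by (simp_all add: ae_equal_def)
  then have eq: "AE x in torus. f x * g x = f' x * g' x"
    by eventually_elim simp
  then have "AE x in torus. (norm (f x * g x))\<^sup>2 = (norm (f' x * g' x))\<^sup>2"
    by eventually_elim simp
  then have "integrable torus (\<lambda>x. (norm (f x * g x))\<^sup>2)
      = integrable torus (\<lambda>x. (norm (f' x * g' x))\<^sup>2)"
    by (intro integrable_cong_AE) auto
  then have "square_integrable (\<lambda>x. f x * g x) = square_integrable (\<lambda>x. f' x * g' x)"
    by (simp add: square_integrable_def)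
  then show "ae_equal
      (if square_integrable (\<lambda>x. f x * g x) then (\<lambda>x. f x * g x) else (\<lambda>x. 0))
      (if square_integrable (\<lambda>x. f' x * g' x) then (\<lambda>x. f' x * g' x) else (\<lambda>x. 0))"
    using eq by (simp add: ae_equal_def square_integrable_zero)
qed

lift_definition real_valued :: "'d::finite L2 \<Rightarrow> bool" is
  "\<lambda>f. AE x in torus. f x \<in> \<real>"
proof -
  fix f g :: "real ^ 'd \<Rightarrow> complex"
  assume "ae_equal f g"
  then have "AE x in torus. f x = g x"
    by (simp add: ae_equal_def)
  then have "AE x in torus. f x \<in> \<real> \<longleftrightarrow> g x \<in> \<real>"
    by eventually_elim simp
  then show "(AE x in torus. f x \<in> \<real>) = (AE x in torus. g x \<in> \<real>)"
    by (rule eventually_subst)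
qed

lift_definition mass :: "'d::finite L2 \<Rightarrow> real" is
  "\<lambda>f. \<integral>x. (norm (f x))\<^sup>2 \<partial>torus"
proof -
  fix f g :: "real ^ 'd \<Rightarrow> complex"
  assume *: "ae_equal f g"
  then have [measurable]: "f \<in> borel_measurable torus" "g \<in> borel_measurable torus"
    by (simp_all add: ae_equal_def square_integrable_def)
  have "AE x in torus. f x = g x"
    using * by (simp add: ae_equal_def)
  then have "AE x in torus. (norm (f x))\<^sup>2 = (norm (g x))\<^sup>2"
    by eventually_elim simp
  then show "(\<integral>x. (norm (f x))\<^sup>2 \<partial>torus) = (\<integral>x. (norm (g x))\<^sup>2 \<partial>torus)"
    by (intro integral_cong_AE) auto
qed


section \<open>Weak derivatives, the Sobolev space of order two and the Laplacian\<close>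

definition partial_derivative ::
    "'d::finite \<Rightarrow> (real ^ 'd \<Rightarrow> complex) \<Rightarrow> real ^ 'd \<Rightarrow> complex" where
  "partial_derivative i \<phi> = (\<lambda>x. frechet_derivative \<phi> (at x) (axis i 1))"

text \<open>A multi-index is given as the list of the directions of differentiation.\<close>

definition partial_derivatives ::
    "'d::finite list \<Rightarrow> (real ^ 'd \<Rightarrow> complex) \<Rightarrow> real ^ 'd \<Rightarrow> complex" where
  "partial_derivatives is \<phi> = foldr partial_derivative is \<phi>"

text \<open>
  Differentiability of all iterated partial derivatives amounts to smoothness, and
  periodicity makes the function one on the torus rather than on the fundamental cell.
\<close>

definition test_function :: "(real ^ 'd::finite \<Rightarrow> complex) \<Rightarrow> bool" where
  "test_function \<phi> \<longleftrightarrow>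
     (\<forall>is x. partial_derivatives is \<phi> differentiable (at x)) \<and>
     (\<forall>i x. \<phi> (x + axis i (2 * pi)) = \<phi> x)"

lemma test_function_measurable:
  assumes "test_function \<phi>"
  shows "partial_derivatives is \<phi> \<in> borel_measurable torus"
proof -
  have "continuous_on UNIV (partial_derivatives is \<phi>)"
    using assms by (auto simp: test_function_def continuous_on_eq_continuous_at
        intro: differentiable_imp_continuous_within)
  then have "partial_derivatives is \<phi> \<in> borel_measurable borel"
    by (rule borel_measurable_continuous_onI)
  then show ?thesis
    by (simp add: torus_def measurable_restrict_space1)
qed

lift_definition has_weak_derivative :: "'d::finite L2 \<Rightarrow> 'd list \<Rightarrow> 'd L2 \<Rightarrow> bool" is
  "\<lambda>f is g. \<forall>\<phi>. test_function \<phi> \<longrightarrow>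
     (\<integral>x. f x * partial_derivatives is \<phi> x \<partial>torus) = (-1) ^ length is * (\<integral>x. g x * \<phi> x \<partial>torus)"
proof -
  fix f f' g g' :: "real ^ 'd \<Rightarrow> complex" and is' :: "'d list"
  have pairing: "(\<integral>x. h x * partial_derivatives js \<phi> x \<partial>torus)
      = (\<integral>x. h' x * partial_derivatives js \<phi> x \<partial>torus)"
    if "ae_equal h h'" "test_function \<phi>" for h h' \<phi> :: "real ^ 'd \<Rightarrow> complex" and js
  proof (rule integral_cong_AE)
    note [measurable] = test_function_measurable[OF that(2)]
    have [measurable]: "h \<in> borel_measurable torus" "h' \<in> borel_measurable torus"
      using that by (simp_all add: ae_equal_def square_integrable_def)
    show "(\<lambda>x. h x * partial_derivatives js \<phi> x) \<in> borel_measurable torus"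
      and "(\<lambda>x. h' x * partial_derivatives js \<phi> x) \<in> borel_measurable torus"
      by measurable
    have "AE x in torus. h x = h' x"
      using that by (simp add: ae_equal_def)
    then show "AE x in torus. h x * partial_derivatives js \<phi> x = h' x * partial_derivatives js \<phi> x"
      by eventually_elim simp
  qed
  assume "ae_equal f f'" "ae_equal g g'"
  then show "(\<forall>\<phi>. test_function \<phi> \<longrightarrow> (\<integral>x. f x * partial_derivatives is' \<phi> x \<partial>torus)
        = (-1) ^ length is' * (\<integral>x. g x * \<phi> x \<partial>torus))
    = (\<forall>\<phi>. test_function \<phi> \<longrightarrow> (\<integral>x. f' x * partial_derivatives is' \<phi> x \<partial>torus)
        = (-1) ^ length is' * (\<integral>x. g' x * \<phi> x \<partial>torus))"
    using pairing[of f f' _ is'] pairing[of g g' _ "[]"]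
    by (simp add: partial_derivatives_def)
qed

definition weak_derivative :: "'d::finite list \<Rightarrow> 'd L2 \<Rightarrow> 'd L2" where
  "weak_derivative is u = (THE g. has_weak_derivative u is g)"

definition H2 :: "'d::finite L2 set" where
  "H2 = {u. \<forall>is. length is \<le> 2 \<longrightarrow> (\<exists>g. has_weak_derivative u is g)}"

text \<open>Only meaningful on \<open>H2\<close>.\<close>

definition laplacian :: "'d::finite L2 \<Rightarrow> 'd L2" where
  "laplacian u = (\<Sum>i\<in>UNIV. weak_derivative [i, i] u)"


section \<open>Unitary groups and operators\<close>

definition unitary_operator :: "('d::finite L2 \<Rightarrow> 'd L2) \<Rightarrow> bool" where
  "unitary_operator U \<longleftrightarrow>
     (\<forall>u v. U (u + v) = U u + U v) \<and> (\<forall>c u. U (c *\<^sub>C u) = c *\<^sub>C U u) \<and>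
     (\<forall>u. norm (U u) = norm u) \<and> surj U"

definition unitary_group :: "(real \<Rightarrow> 'd::finite L2 \<Rightarrow> 'd L2) \<Rightarrow> bool" where
  "unitary_group S \<longleftrightarrow>
     (\<forall>t. unitary_operator (S t)) \<and> S 0 = id \<and> (\<forall>s t. S (s + t) = S s \<circ> S t) \<and>
     (\<forall>u. continuous_on UNIV (\<lambda>t. S t u))"

text \<open>
  \<open>A\<close>, with domain \<open>D\<close>, is the infinitesimal generator of \<open>S\<close>; the values of \<open>A\<close> outside \<open>D\<close>
  are irrelevant.
\<close>

definition generator_of ::
    "(real \<Rightarrow> 'd::finite L2 \<Rightarrow> 'd L2) \<Rightarrow> 'd L2 set \<Rightarrow> ('d L2 \<Rightarrow> 'd L2) \<Rightarrow> bool" where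
  "generator_of S D A \<longleftrightarrow>
     D = {u. \<exists>v. ((\<lambda>h. (S h u - u) /\<^sub>R h) \<longlongrightarrow> v) (at 0)} \<and>
     (\<forall>u\<in>D. ((\<lambda>h. (S h u - u) /\<^sub>R h) \<longlongrightarrow> A u) (at 0))"

text \<open>\<open>S(t) = exp (- \<i> t \<Delta>)\<close>\<close>

definition schroedinger_group :: "(real \<Rightarrow> 'd::finite L2 \<Rightarrow> 'd L2) \<Rightarrow> bool" where
  "schroedinger_group S \<longleftrightarrow>
     unitary_group S \<and> generator_of S H2 (\<lambda>u. (- \<i>) *\<^sub>C laplacian u)"

definition nonneg_selfadjoint :: "('a::real_inner \<Rightarrow> 'a) \<Rightarrow> bool" where
  "nonneg_selfadjoint Q \<longleftrightarrow>
     bounded_linear Q \<and> (\<forall>u v. inner (Q u) v = inner u (Q v)) \<and> (\<forall>u. 0 \<le> inner (Q u) u)"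

text \<open>\<open>R = Q\<^sup>1\<^sup>/\<^sup>2\<close>\<close>

definition square_root_of :: "('a::real_inner \<Rightarrow> 'a) \<Rightarrow> ('a \<Rightarrow> 'a) \<Rightarrow> bool" where
  "square_root_of Q R \<longleftrightarrow> nonneg_selfadjoint R \<and> R \<circ> R = Q"

definition orthonormal_basis :: "(nat \<Rightarrow> 'a::real_inner) \<Rightarrow> bool" where
  "orthonormal_basis e \<longleftrightarrow>
     (\<forall>i j. inner (e i) (e j) = (if i = j then 1 else 0)) \<and> closure (span (range e)) = UNIV"


section \<open>Wiener processes\<close>

definition normal_filtration :: "'w measure \<Rightarrow> (real \<Rightarrow> 'w measure) \<Rightarrow> bool" where
  "normal_filtration M F \<longleftrightarrow>
     (\<forall>t\<ge>0. subalgebra M (F t)) \<and>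
     (\<forall>s t. 0 \<le> s \<longrightarrow> s \<le> t \<longrightarrow> sets (F s) \<subseteq> sets (F t)) \<and>
     (\<forall>t\<ge>0. sets (F t) = (\<Inter>s\<in>{t<..}. sets (F s))) \<and>
     null_sets M \<subseteq> sets (F 0)"

definition real_gaussian :: "real \<Rightarrow> real measure" where
  "real_gaussian v =
     (if v = 0 then return borel 0 else density lborel (normal_density 0 (sqrt v)))"

text \<open>The law \<open>N(0, Q)\<close>, determined by its one-dimensional projections.\<close>

definition centred_gaussian :: "'a::real_inner measure \<Rightarrow> ('a \<Rightarrow> 'a) \<Rightarrow> bool" where
  "centred_gaussian \<mu> Q \<longleftrightarrow>
     sets \<mu> = sets borel \<and>
     (\<forall>v. distr \<mu> borel (\<lambda>x. inner x v) = real_gaussian (inner (Q v) v))"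

text \<open>
  The definition of Da Prato and Zabczyk; only times \<open>t \<ge> 0\<close> matter. It is satisfied by (the
  continuous version of) an expansion \<open>W(t) = \<Sum>\<^sub>j \<beta>\<^sub>j(t) Q\<^sup>1\<^sup>/\<^sup>2 e\<^sub>j\<close> in independent standard
  real Brownian motions.
\<close>

definition Q_Wiener_process ::
    "'w measure \<Rightarrow> ('a::real_inner \<Rightarrow> 'a) \<Rightarrow> (real \<Rightarrow> 'w \<Rightarrow> 'a) \<Rightarrow> bool" where
  "Q_Wiener_process M Q W \<longleftrightarrow>
     (\<forall>t\<ge>0. W t \<in> borel_measurable M) \<and>
     (AE \<omega> in M. W 0 \<omega> = 0) \<and>
     (AE \<omega> in M. continuous_on {0..} (\<lambda>t. W t \<omega>)) \<and>
     (\<forall>n t. 0 \<le> t 0 \<longrightarrow> (\<forall>i<n. t i \<le> t (Suc i)) \<longrightarrow>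
        prob_space.indep_vars M (\<lambda>_. borel) (\<lambda>i \<omega>. W (t (Suc i)) \<omega> - W (t i) \<omega>) {..<n::nat}) \<and>
     (\<forall>s t. 0 \<le> s \<longrightarrow> s \<le> t \<longrightarrow>
        centred_gaussian (distr M borel (\<lambda>\<omega>. W t \<omega> - W s \<omega>)) (\<lambda>v. (t - s) *\<^sub>R Q v))"

definition Q_Wiener_process_wrt ::
    "'w measure \<Rightarrow> (real \<Rightarrow> 'w measure) \<Rightarrow> ('a::real_inner \<Rightarrow> 'a) \<Rightarrow> (real \<Rightarrow> 'w \<Rightarrow> 'a) \<Rightarrow> bool" where
  "Q_Wiener_process_wrt M F Q W \<longleftrightarrow>
     Q_Wiener_process M Q W \<and>
     (\<forall>t\<ge>0. W t \<in> borel_measurable (F t)) \<and>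
     (\<forall>s t. 0 \<le> s \<longrightarrow> s \<le> t \<longrightarrow>
        prob_space.indep_set M (sets (F s))
          (sets (vimage_algebra (space M) (\<lambda>\<omega>. W t \<omega> - W s \<omega>) borel)))"


section \<open>The stochastic exponential integrator\<close>

primrec exponential_integrator ::
    "(real \<Rightarrow> 'd::finite L2 \<Rightarrow> 'd L2) \<Rightarrow> 'd L2 \<Rightarrow> (real \<Rightarrow> 'w \<Rightarrow> 'd L2) \<Rightarrow> ('w \<Rightarrow> 'd L2) \<Rightarrow> real
     \<Rightarrow> nat \<Rightarrow> 'w \<Rightarrow> 'd L2" where
  "exponential_integrator S V W u\<^sub>0 k 0 = u\<^sub>0"
| "exponential_integrator S V W u\<^sub>0 k (Suc n) = (\<lambda>\<omega>.
     S k (exponential_integrator S V W u\<^sub>0 k n \<omega>)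
     - (\<i> * of_real k) *\<^sub>C S k (mult_L2 V (exponential_integrator S V W u\<^sub>0 k n \<omega>))
     - \<i> *\<^sub>C S k (W (real (Suc n) * k) \<omega> - W (real n * k) \<omega>))"

end

theory Submission
  imports Defs
begin

text \<open>
Write \<open>X = u - \<i> k V u\<close>, where \<open>u\<close> is the current iterate. As \<open>S(k)\<close> is an isometry, the next
iterate has the norm of \<open>X - \<i> \<Delta>W\<close>. Since \<open>V\<close> is real, \<open>\<i> V u\<close> is orthogonal to \<open>u\<close>
(\<open>inner_i_potential_eq_zero\<close>), so that \<open>\<parallel>X\<parallel>\<^sup>2 = \<parallel>u\<parallel>\<^sup>2 + k\<^sup>2 \<parallel>V u\<parallel>\<^sup>2\<close>: the potential changes the mass at
second order only. The increment \<open>\<Delta>W\<close> is centred and independent of the past, hence the mixed term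
vanishes in expectation (\<open>expectation_inner_independent\<close>), and the increment contributes exactly
\<open>\<bbbE> \<parallel>\<Delta>W\<parallel>\<^sup>2 = k Tr(Q)\<close> (\<open>centred_gaussian_norm_square\<close>). This gives
\<open>\<bbbE> M(u\<^sup>n\<^sup>+\<^sup>1) = \<bbbE> M(u\<^sup>n) + k\<^sup>2 \<bbbE> \<parallel>V u\<^sup>n\<parallel>\<^sup>2 + k Tr(Q)\<close>. If \<open>V\<close> is bounded by \<open>B\<close>, the middle term is at most
\<open>k\<^sup>2 B\<^sup>2 \<bbbE> M(u\<^sup>n)\<close>, and a discrete Gronwall argument bounds its sum over at most \<open>T/k\<close> steps by a
multiple of \<open>k\<close> (\<open>perturbed_recursion_linear_growth\<close>).

It remains to see that \<open>V\<close> is essentially bounded, the Sobolev embedding of \<open>H2\<close> in dimension at most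
three (\<open>H2_essentially_bounded\<close>). Testing the weak derivatives against Fourier modes shows that the
coefficients \<open>c\<^sub>n\<close> of \<open>V\<close> satisfy \<open>\<Sum> (1 + \<Sum>\<^sub>i n\<^sub>i\<^sup>4) \<bar>c\<^sub>n\<bar>\<^sup>2 < \<infinity>\<close>. As \<open>\<Sum> 1 / (1 + \<Sum>\<^sub>i n\<^sub>i\<^sup>4)\<close> converges
for \<open>d \<le> 3\<close>, the coefficients are absolutely summable, so the Fourier series converges to a bounded
function. That this function is \<open>V\<close> rests on the uniqueness of Fourier coefficients of integrable
functions (\<open>fourier_uniqueness\<close>), which comes from the Stone-Weierstrass theorem.

Measurability of random elements of the Lebesgue space is handled through scalar products only: sums
and images under operators with an adjoint inherit it at once, and an orthonormal basis
recovers measurability of norms.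
\<close>

section \<open>Fourier modes on the torus\<close>

definition torus_cell :: "(real ^ 'd::finite) set" where
  "torus_cell = {x. \<forall>i. 0 \<le> x $ i \<and> x $ i < 2 * pi}"

lemma torus_cell_measurable [measurable]: "torus_cell \<in> sets borel"
proof -
  have "torus_cell = {x \<in> space borel. \<forall>i. 0 \<le> x $ i \<and> x $ i < 2 * pi}"
    by (simp add: torus_cell_def)
  also have "\<dots> \<in> sets borel"
    by measurable
  finally show ?thesis .
qed

lemma torus_eq: "torus = restrict_space lborel torus_cell"
  by (simp add: torus_def torus_cell_def)

lemma space_torus: "space torus = torus_cell"
  by (simp add: torus_eq space_restrict_space)

lemma finite_measure_torus: "finite_measure (torus :: (real ^ 'd::finite) measure)"
proof
  have "(torus_cell :: (real ^ 'd) set) \<subseteq> cbox 0 (\<chi> i. 2 * pi)"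
    by (auto simp: torus_cell_def mem_box_cart less_imp_le)
  then have "emeasure lborel (torus_cell :: (real ^ 'd) set) \<le> emeasure lborel (cbox 0 ((\<chi> i. 2 * pi) :: real ^ 'd))"
    by (intro emeasure_mono) auto
  also have "\<dots> < \<infinity>"
    using emeasure_compact_finite[OF compact_cbox] by blast
  finally show "emeasure torus (space torus :: (real ^ 'd) set) \<noteq> \<infinity>"
    by (auto simp: torus_eq space_restrict_space emeasure_restrict_space)
qed

lemma measurable_torus: "f \<in> borel_measurable borel \<Longrightarrow> f \<in> borel_measurable torus"
  by (simp add: torus_def measurable_restrict_space1)

text \<open>
Lebesgue measure on \<open>\<real>\<^sup>n\<close> is the image of a product measure indexed by the standard basis, so Fubini
applies once the basis vectors are reindexed by the coordinates.
\<close>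

lemma lborel_integral_prod_coordinates:
  fixes f :: "'n::finite \<Rightarrow> real \<Rightarrow> complex"
  assumes "\<And>i. integrable lborel (f i)"
  shows "(\<integral>x. (\<Prod>i\<in>UNIV. f i (x $ i)) \<partial>(lborel :: (real ^ 'n) measure)) = (\<Prod>i\<in>UNIV. \<integral>t. f i t \<partial>lborel)"
proof -
  interpret product_sigma_finite "\<lambda>_ :: real ^ 'n. lborel :: real measure"
    by (simp add: product_sigma_finite_def sigma_finite_lborel)
  have [measurable]: "f i \<in> borel_measurable borel" for i
    using borel_measurable_integrable[OF assms[of i]] by simp
  have ax: "bij_betw (\<lambda>i. axis i 1) UNIV (Basis :: (real ^ 'n) set)"
    by (auto simp: bij_betw_def inj_on_def axis_eq_axis Basis_vec_def)
  define g where "g b = f (inv_into UNIV (\<lambda>i. axis i 1) b)" for b :: "real ^ 'n"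
  have g: "g (axis i 1) = f i" for i
    using bij_betw_inv_into_left[OF ax, of i] by (simp add: g_def)
  have comp: "(\<Sum>b\<in>Basis. w b *\<^sub>R b) $ i = w (axis i 1)" for w :: "real ^ 'n \<Rightarrow> real" and i
    by (simp add: sum.reindex_bij_betw[OF ax, symmetric] axis_def if_distrib cong: if_cong)
  have "(\<integral>x. (\<Prod>i\<in>UNIV. f i (x $ i)) \<partial>(lborel :: (real ^ 'n) measure))
      = (\<integral>w. (\<Prod>i\<in>UNIV. f i ((\<Sum>b\<in>Basis. w b *\<^sub>R b) $ i)) \<partial>(\<Pi>\<^sub>M b\<in>(Basis :: (real ^ 'n) set). lborel))"
    by (subst lborel_eq, subst integral_distr) measurable
  also have "\<dots> = (\<integral>w. (\<Prod>b\<in>Basis. g b (w b)) \<partial>(\<Pi>\<^sub>M b\<in>(Basis :: (real ^ 'n) set). lborel))"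
    by (simp only: comp prod.reindex_bij_betw[OF ax, symmetric] g)
  also have "\<dots> = (\<Prod>b\<in>(Basis :: (real ^ 'n) set). \<integral>t. g b t \<partial>lborel)"
    by (rule product_integral_prod) (auto simp: g_def assms)
  also have "\<dots> = (\<Prod>i\<in>UNIV. \<integral>t. f i t \<partial>lborel)"
    by (simp add: prod.reindex_bij_betw[OF ax, symmetric] g)
  finally show ?thesis .
qed

definition fourier_mode :: "('d::finite \<Rightarrow> int) \<Rightarrow> real ^ 'd \<Rightarrow> complex" where
  "fourier_mode n x = cis (\<Sum>i\<in>UNIV. of_int (n i) * x $ i)"

lemma norm_fourier_mode [simp]: "norm (fourier_mode n x) = 1"
  by (simp add: fourier_mode_def)

lemma fourier_mode_mult: "fourier_mode m x * fourier_mode n x = fourier_mode (\<lambda>i. m i + n i) x"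
  by (simp add: fourier_mode_def cis_mult sum.distrib distrib_right)

lemma cnj_fourier_mode: "cnj (fourier_mode n x) = fourier_mode (\<lambda>i. - n i) x"
  by (simp add: fourier_mode_def cis_cnj sum_negf)

lemma measurable_fourier_mode [measurable]: "fourier_mode n \<in> borel_measurable torus"
  unfolding fourier_mode_def cis_conv_exp
  by (intro measurable_torus borel_measurable_continuous_onI continuous_intros)

lemma integral_cis_period:
  fixes k :: int
  shows "(\<integral>t. indicator {0..<2 * pi} t *\<^sub>R cis (of_int k * t) \<partial>lborel) = (if k = 0 then 2 * pi else 0)"
proof -
  have "(\<integral>t. indicator {0..<2 * pi} t *\<^sub>R cis (of_int k * t) \<partial>lborel)
      = (\<integral>t. indicator {0..2 * pi} t *\<^sub>R cis (of_int k * t) \<partial>lborel)"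
  proof (rule integral_cong_AE)
    show "AE t in lborel. indicator {0..<2 * pi} t *\<^sub>R cis (of_int k * t)
        = indicator {0..2 * pi} t *\<^sub>R cis (of_int k * t)"
      using AE_lborel_singleton[of "2 * pi"]
      by eventually_elim (auto simp: indicator_def)
  qed (unfold cis_conv_exp, measurable)
  also have "\<dots> = (if k = 0 then 2 * pi else 0)"
  proof (cases "k = 0")
    case False
    have der: "((\<lambda>t. cis (of_int k * t) / (\<i> * of_int k)) has_vector_derivative cis (of_int k * t))
        (at t within A)" for t A
    proof -
      have "((\<lambda>z. exp (\<i> * (of_int k * z)) / (\<i> * of_int k)) has_field_derivative
          exp (\<i> * (of_int k * of_real t))) (at (of_real t))"
        using False by (auto intro!: derivative_eq_intros simp: field_simps)
      from has_vector_derivative_real_field[OF this] show ?thesis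
        by (simp add: cis_conv_exp)
    qed
    have per: "cis (of_int k * (2 * pi)) = 1"
      using cis_multiple_2pi[of "of_int k"] by (simp add: mult_ac)
    have "(\<integral>t. indicator {0..2 * pi} t *\<^sub>R cis (of_int k * t) \<partial>lborel)
        = cis (of_int k * (2 * pi)) / (\<i> * of_int k) - cis (of_int k * 0) / (\<i> * of_int k)"
      by (rule integral_FTC_Icc) (use der in \<open>auto simp: cis_conv_exp intro!: continuous_intros\<close>)
    with False show ?thesis
      by (simp add: per)
  qed (simp add: scaleR_conv_of_real)
  finally show ?thesis .
qed

text \<open>
Cut off to the fundamental cell, a Fourier mode is a product of functions of one coordinate each, and
a factor with nonzero frequency integrates to zero over its period.
\<close>

lemma integral_fourier_mode:
  "(\<integral>x. fourier_mode n x \<partial>(torus :: (real ^ 'd::finite) measure))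
    = (if n = (\<lambda>_. 0) then (2 * pi) ^ CARD('d) else 0)"
proof -
  have ind: "indicator torus_cell x *\<^sub>R fourier_mode n x
      = (\<Prod>i\<in>UNIV. indicator {0..<2 * pi} (x $ i) *\<^sub>R cis (of_int (n i) * x $ i))" for x :: "real ^ 'd"
  proof (cases "x \<in> torus_cell")
    case True
    then show ?thesis
      by (simp add: torus_cell_def fourier_mode_def cis_conv_exp sum_distrib_left exp_sum)
  next
    case False
    then obtain i where "x $ i \<notin> {0..<2 * pi}"
      by (auto simp: torus_cell_def)
    then have "(\<Prod>i\<in>UNIV. indicator {0..<2 * pi} (x $ i) *\<^sub>R cis (of_int (n i) * x $ i)) = 0"
      by (intro prod_zero) (auto intro!: exI[of _ i])
    with False show ?thesis
      by simp
  qed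
  have "(\<integral>x. fourier_mode n x \<partial>(torus :: (real ^ 'd) measure))
      = (\<integral>x. indicator torus_cell x *\<^sub>R fourier_mode n x \<partial>lborel)"
    unfolding torus_eq by (subst integral_restrict_space) simp_all
  also have "\<dots> = (\<Prod>i\<in>UNIV. \<integral>t. indicator {0..<2 * pi} t *\<^sub>R cis (of_int (n i) * t) \<partial>lborel)"
    unfolding ind
  proof (rule lborel_integral_prod_coordinates)
    fix i
    have "integrable lborel (\<lambda>t. indicator {0..<2 * pi} t *\<^sub>R (1::complex))"
      by (simp add: integrable_indicator_iff)
    then show "integrable lborel (\<lambda>t. indicator {0..<2 * pi} t *\<^sub>R cis (of_int (n i) * t))"
      by (rule Bochner_Integration.integrable_bound)
        (auto simp: cis_conv_exp norm_mult intro!: borel_measurable_times borel_measurable_of_real)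
  qed
  also have "\<dots> = (\<Prod>i\<in>UNIV. if n i = 0 then 2 * pi else 0)"
    by (simp add: integral_cis_period if_distrib cong: if_cong)
  also have "\<dots> = (if n = (\<lambda>_. 0) then (2 * pi) ^ CARD('d) else 0)"
  proof (cases "n = (\<lambda>_. 0)")
    case False
    then obtain i where "n i \<noteq> 0"
      by auto
    then have "(\<Prod>i\<in>UNIV. if n i = 0 then 2 * pi else 0) = 0"
      by (intro prod_zero) (auto intro!: exI[of _ i])
    with False show ?thesis
      by simp
  qed simp
  finally show ?thesis .
qed

lemma fourier_mode_orthogonal:
  "(\<integral>x. fourier_mode m x * cnj (fourier_mode n x) \<partial>(torus :: (real ^ 'd::finite) measure))
    = (if m = n then (2 * pi) ^ CARD('d) else 0)"
proof -
  have "(\<lambda>i. m i - n i) = (\<lambda>_. 0) \<longleftrightarrow> m = n"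
    by (auto simp: fun_eq_iff)
  then show ?thesis
    by (simp add: cnj_fourier_mode fourier_mode_mult integral_fourier_mode)
qed


section \<open>Uniqueness of Fourier coefficients\<close>

text \<open>
The integrable functions orthogonal to all Fourier modes; the frequencies run over all signs, so the
mode need not be conjugated.
\<close>

definition fourier_null :: "(real ^ 'd::finite \<Rightarrow> complex) \<Rightarrow> bool" where
  "fourier_null h \<longleftrightarrow> integrable torus h \<and> (\<forall>n. (\<integral>x. fourier_mode n x * h x \<partial>torus) = 0)"

lemma integrable_fourier_mode_mult:
  assumes "integrable torus h"
  shows "integrable torus (\<lambda>x. fourier_mode n x * h x)"
proof (rule Bochner_Integration.integrable_bound[OF assms])
  note [measurable] = borel_measurable_integrable[OF assms]
  show "(\<lambda>x. fourier_mode n x * h x) \<in> borel_measurable torus"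
    by measurable
qed (simp add: norm_mult)

lemma fourier_null_add:
  assumes "fourier_null g" "fourier_null h"
  shows "fourier_null (\<lambda>x. g x + h x)"
  using assms by (simp add: fourier_null_def distrib_left integrable_fourier_mode_mult)

lemma fourier_null_scale:
  assumes "fourier_null h"
  shows "fourier_null (\<lambda>x. c * h x)"
  using assms by (simp add: fourier_null_def mult.left_commute[of _ c])

lemma fourier_null_sum:
  assumes "\<And>i. i \<in> I \<Longrightarrow> fourier_null (f i)"
  shows "fourier_null (\<lambda>x. \<Sum>i\<in>I. f i x)"
  using assms
proof (induction I rule: infinite_finite_induct)
  case (insert i I)
  then show ?case
    by (simp add: fourier_null_add)
qed (simp_all add: fourier_null_def)

lemma fourier_null_mode:
  assumes "fourier_null h"
  shows "fourier_null (\<lambda>x. fourier_mode n x * h x)"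
  using assms
  by (simp add: fourier_null_def integrable_fourier_mode_mult mult.assoc[symmetric] fourier_mode_mult)

text \<open>
The embedding of the torus into \<open>\<complex>\<^sup>d\<close>. Its image is bounded, which makes polynomial approximation
available, and trigonometric polynomials become polynomials on it.
\<close>

definition unit_phases :: "real ^ 'd::finite \<Rightarrow> complex ^ 'd" where
  "unit_phases x = (\<chi> i. cis (x $ i))"

lemma unit_phases_nth [simp]: "unit_phases x $ i = cis (x $ i)"
  by (simp add: unit_phases_def)

lemma continuous_unit_phases: "continuous_on A unit_phases"
  unfolding unit_phases_def cis_conv_exp by (intro continuous_intros)

lemma measurable_unit_phases [measurable]: "unit_phases \<in> borel_measurable torus"
  by (intro measurable_torus borel_measurable_continuous_onI continuous_unit_phases)

lemma fourier_mode_single: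
  "fourier_mode (\<lambda>j. if j = i then 1 else 0) x = cis (x $ i)"
  "fourier_mode (\<lambda>j. if j = i then - 1 else 0) x = cis (- x $ i)"
  by (simp_all add: fourier_mode_def if_distrib if_distribR cong: if_cong)

text \<open>
Being orthogonal to all modes is stable under multiplication by a mode, hence by the real and
imaginary parts of the phases, and therefore by every polynomial in them. Stating this for all \<open>h\<close> at
once makes products of polynomials a mere iteration.
\<close>

lemma fourier_null_polynomial:
  fixes p :: "complex ^ 'd::finite \<Rightarrow> real"
  assumes "real_polynomial_function p" "fourier_null h"
  shows "fourier_null (\<lambda>x. of_real (p (unit_phases x)) * h x)"
  using assms
proof (induction arbitrary: h)
  case (linear f)
  have lin: "f y = (\<Sum>i\<in>UNIV. Re (y $ i) * f (axis i 1) + Im (y $ i) * f (axis i \<i>))" for y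
  proof -
    have comp: "axis i c = Re c *\<^sub>R axis i 1 + Im c *\<^sub>R (axis i \<i> :: complex ^ 'd)" for i c
      by (simp add: vec_eq_iff axis_def complex_eq_iff)
    note lf = bounded_linear.linear[OF linear.hyps]
    have scal: "f (axis i c) = Re c * f (axis i 1) + Im c * f (axis i \<i>)" for i c
      unfolding comp[of i c] linear_add[OF lf] linear_scale[OF lf] by simp
    have "y = (\<Sum>i\<in>UNIV. axis i (y $ i))"
      by (simp add: vec_eq_iff axis_def sum.delta if_distrib cong: if_cong)
    also have "f \<dots> = (\<Sum>i\<in>UNIV. f (axis i (y $ i)))"
      by (rule linear_sum[OF lf])
    also have "\<dots> = (\<Sum>i\<in>UNIV. Re (y $ i) * f (axis i 1) + Im (y $ i) * f (axis i \<i>))"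
      by (rule sum.cong[OF refl scal])
    finally show ?thesis .
  qed
  have trig: "of_real (cos t * a + sin t * b) * w
      = (of_real a / 2 + of_real b / (2 * \<i>)) * (cis t * w) + (of_real a / 2 - of_real b / (2 * \<i>)) * (cis (- t) * w)"
    for t a b :: real and w
    by (simp add: complex_eq_iff field_simps)
  have "of_real (f (unit_phases x)) * h x
     = (\<Sum>i\<in>UNIV. (f (axis i 1) / 2 + f (axis i \<i>) / (2 * \<i>)) * (fourier_mode (\<lambda>j. if j = i then 1 else 0) x * h x)
          + (f (axis i 1) / 2 - f (axis i \<i>) / (2 * \<i>)) * (fourier_mode (\<lambda>j. if j = i then - 1 else 0) x * h x))" for x
    unfolding lin[of "unit_phases x"] fourier_mode_single of_real_sum sum_distrib_right
    by (rule sum.cong[OF refl]) (simp only: unit_phases_nth cis.sel trig, simp)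
  then show ?case
    by (auto intro!: fourier_null_sum fourier_null_add fourier_null_scale fourier_null_mode linear.prems)
next
  case (const c)
  then show ?case
    by (rule fourier_null_scale)
next
  case (add f g)
  then show ?case
    by (simp add: distrib_right fourier_null_add)
next
  case (mult f g)
  then show ?case
    using mult.IH(1)[OF mult.IH(2)[OF mult.prems]] by (simp add: mult.assoc)
qed

lemma integral_fourier_null: "fourier_null h \<Longrightarrow> (\<integral>x. h x \<partial>torus) = 0"
  unfolding fourier_null_def by (auto dest!: spec[of _ "\<lambda>_. 0"] simp: fourier_mode_def)

text \<open>
By Stone-Weierstrass the continuous function \<open>q\<close> is uniformly close to a polynomial on a ball that
contains all phases, and the integral against a polynomial vanishes.
\<close>

lemma integral_continuous_fourier_null:
  fixes q :: "complex ^ 'd::finite \<Rightarrow> real"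
  assumes "continuous_on UNIV q" "fourier_null h"
  shows "integrable torus (\<lambda>x. of_real (q (unit_phases x)) * h x)"
    and "(\<integral>x. of_real (q (unit_phases x)) * h x \<partial>torus) = 0"
proof -
  have h: "integrable torus h"
    using assms by (simp add: fourier_null_def)
  note [measurable] = borel_measurable_integrable[OF h] borel_measurable_continuous_onI[OF assms(1)]
  \<comment> \<open>Each of the \<open>d\<close> phases has modulus one, so the vector of phases has norm \<open>sqrt d\<close>.\<close>
  define K :: "(complex ^ 'd) set" where "K = cball 0 (sqrt CARD('d))"
  have K: "compact K" "unit_phases x \<in> K" for x
    by (auto simp: K_def norm_vec_def L2_set_def)
  have q: "continuous_on K q"
    using assms(1) continuous_on_subset by blast
  obtain B where B: "\<bar>q y\<bar> \<le> B" if "y \<in> K" for y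
    using compact_imp_bounded[OF compact_continuous_image[OF q K(1)]]
    by (auto simp: bounded_iff)
  show int: "integrable torus (\<lambda>x. of_real (q (unit_phases x)) * h x)"
  proof (rule Bochner_Integration.integrable_bound[of _ "\<lambda>x. B * norm (h x)"])
    show "(\<lambda>x. of_real (q (unit_phases x)) * h x) \<in> borel_measurable torus"
      by measurable
    have "\<bar>q (unit_phases x)\<bar> * norm (h x) \<le> \<bar>B\<bar> * norm (h x)" for x
      using B[OF K(2)[of x]] by (intro mult_right_mono) auto
    then show "AE x in torus. norm (of_real (q (unit_phases x)) * h x) \<le> norm (B * norm (h x))"
      by (simp add: norm_mult abs_mult)
  qed (use h in simp)
  have "norm (\<integral>x. of_real (q (unit_phases x)) * h x \<partial>torus) \<le> \<epsilon> * (\<integral>x. norm (h x) \<partial>torus)"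
    if eps: "0 < \<epsilon>" for \<epsilon>
  proof -
    obtain p where p: "real_polynomial_function p" "\<And>y. y \<in> K \<Longrightarrow> \<bar>q y - p y\<bar> < \<epsilon>"
      using Stone_Weierstrass_real_polynomial_function[OF K(1) q eps] by blast
    let ?p = "\<lambda>x. of_real (p (unit_phases x)) * h x"
    have null: "fourier_null ?p"
      using p(1) assms(2) by (rule fourier_null_polynomial)
    then have ip: "integrable torus ?p"
      by (simp add: fourier_null_def)
    have "norm (\<integral>x. of_real (q (unit_phases x)) * h x \<partial>torus)
        = norm (\<integral>x. of_real (q (unit_phases x)) * h x - ?p x \<partial>torus)"
      by (simp add: int ip integral_fourier_null[OF null])
    also have "\<dots> \<le> (\<integral>x. \<epsilon> * norm (h x) \<partial>torus)"
    proof (rule Bochner_Integration.integral_norm_bound_integral)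
      fix x
      have "norm (of_real (q (unit_phases x)) * h x - ?p x)
          = \<bar>q (unit_phases x) - p (unit_phases x)\<bar> * norm (h x)"
        by (simp flip: left_diff_distrib of_real_diff add: norm_mult)
      also have "\<dots> \<le> \<epsilon> * norm (h x)"
        using p(2)[OF K(2)[of x]] by (intro mult_right_mono) auto
      finally show "norm (of_real (q (unit_phases x)) * h x - ?p x) \<le> \<epsilon> * norm (h x)" .
    qed (use int ip h in auto)
    finally show ?thesis
      by simp
  qed
  note small = this
  define H where "H = (\<integral>x. norm (h x) \<partial>torus)"
  have "0 \<le> H"
    by (simp add: H_def)
  have "norm (\<integral>x. of_real (q (unit_phases x)) * h x \<partial>torus) \<le> 0 + \<delta>" if "0 < \<delta>" for \<delta>
  proof -
    \<comment> \<open>The summand \<open>1\<close> covers the case that \<open>H\<close> is zero.\<close>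
    have "0 < \<delta> / (H + 1)"
      using \<open>0 \<le> H\<close> that by simp
    from small[OF this, folded H_def]
    have "norm (\<integral>x. of_real (q (unit_phases x)) * h x \<partial>torus) \<le> \<delta> / (H + 1) * H" .
    also have "\<dots> \<le> \<delta>"
      using \<open>0 \<le> H\<close> that by (simp add: divide_simps)
    finally show ?thesis
      by simp
  qed
  from field_le_epsilon[OF this] show "(\<integral>x. of_real (q (unit_phases x)) * h x \<partial>torus) = 0"
    by simp
qed

text \<open>
The indicator of a closed set \<open>C\<close> is the limit of the continuous functions \<open>(1 / (1 + dist(y, C)))\<^sup>m\<close>,
which settles closed sets; they form an intersection-stable generator of the Borel sets.
\<close>

lemma integral_borel_fourier_null:
  fixes B :: "(complex ^ 'd::finite) set"
  assumes h: "fourier_null h" and B: "B \<in> sets borel"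
  shows "(\<integral>x. indicator B (unit_phases x) *\<^sub>R h x \<partial>torus) = 0"
proof -
  have ih: "integrable torus h"
    using h by (simp add: fourier_null_def)
  note [measurable] = borel_measurable_integrable[OF ih]
  have int: "integrable torus (\<lambda>x. indicator C (unit_phases x) *\<^sub>R h x)" if [measurable]: "C \<in> sets borel"
    for C :: "(complex ^ 'd) set"
    by (rule Bochner_Integration.integrable_bound[OF ih]) (measurable, simp add: indicator_def)
  have "Int_stable (Collect closed :: (complex ^ 'd) set set)"
    by (auto simp: Int_stable_def)
  moreover have "(Collect closed :: (complex ^ 'd) set set) \<subseteq> Pow UNIV"
    by simp
  moreover have "B \<in> sigma_sets UNIV (Collect closed)"
    using B by (simp add: borel_eq_closed)
  ultimately show ?thesis
  proof (induction rule: sigma_sets_induct_disjoint)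
    case (basic C)
    show ?case
    proof (cases "C = {}")
      case False
      define q where "q m y = (1 / (1 + infdist y C)) ^ m" for m :: nat and y
      have pos: "0 < 1 + infdist y C" for y
        using infdist_nonneg[of y C] by simp
      have q: "continuous_on UNIV (q m)" for m
        unfolding q_def by (intro continuous_intros) (metis pos less_irrefl)
      note [measurable] = borel_measurable_continuous_onI[OF q]
      have qC: "(\<lambda>m. q m y) \<longlonglongrightarrow> indicator C y" for y
      proof (cases "y \<in> C")
        case True
        then show ?thesis
          by (simp add: q_def)
      next
        case nin: False
        then have "infdist y C \<noteq> 0"
          using basic False by (simp add: in_closed_iff_infdist_zero)
        then have "0 < infdist y C"
          using infdist_nonneg[of y C] by simp
        then show ?thesis
          using nin unfolding q_def by (simp add: LIMSEQ_power_zero)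
      qed
      have C: "C \<in> sets borel"
        using basic by auto
      have "(\<lambda>m. \<integral>x. of_real (q m (unit_phases x)) * h x \<partial>torus)
          \<longlonglongrightarrow> (\<integral>x. indicator C (unit_phases x) *\<^sub>R h x \<partial>torus)"
      proof (rule integral_dominated_convergence[where w = "\<lambda>x. norm (h x)"])
        show "AE x in torus. (\<lambda>m. of_real (q m (unit_phases x)) * h x)
            \<longlonglongrightarrow> indicator C (unit_phases x) *\<^sub>R h x"
          using qC unfolding scaleR_conv_of_real by (intro AE_I2 tendsto_intros) auto
        fix m
        have "q m y \<le> 1" "0 \<le> q m y" for y
          using pos[of y] infdist_nonneg[of y C] by (auto simp: q_def intro!: power_le_one)
        then show "AE x in torus. norm (of_real (q m (unit_phases x)) * h x) \<le> norm (h x)"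
          by (simp add: norm_mult mult_left_le_one_le)
        show "(\<lambda>x. of_real (q m (unit_phases x)) * h x) \<in> borel_measurable torus"
          by measurable
      qed (use ih borel_measurable_integrable[OF int[OF C]] in auto)
      then show ?thesis
        by (simp add: integral_continuous_fourier_null[OF q h] LIMSEQ_const_iff)
    qed simp
  next
    case (compl A)
    then have "A \<in> sets borel"
      by (simp add: borel_eq_closed)
    moreover have "indicator (UNIV - A) y *\<^sub>R z = z - indicator A y *\<^sub>R z" for y and z :: complex
      by (simp add: indicator_def)
    ultimately show ?case
      using compl by (simp add: int ih integral_fourier_null[OF h])
  next
    case (union A)
    then have A: "A i \<in> sets borel" for i
      by (auto simp: borel_eq_closed)
    let ?P = "\<lambda>i. unit_phases -` A i \<inter> space torus"
    have ind: "indicator C (unit_phases x) = indicator (unit_phases -` C \<inter> space torus) x"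
      if "x \<in> space torus" for x and C :: "(complex ^ 'd) set"
      using that by (simp add: indicator_def)
    have eq: "(\<integral>x. indicator C (unit_phases x) *\<^sub>R h x \<partial>torus)
        = (LINT x : unit_phases -` C \<inter> space torus | torus. h x)" for C
      unfolding set_lebesgue_integral_def by (rule Bochner_Integration.integral_cong) (simp_all add: ind)
    have "(LINT x : (\<Union>i. ?P i) | torus. h x) = (\<Sum>i. LINT x : ?P i | torus. h x)"
    proof (rule lebesgue_integral_countable_add)
      have "(\<Union>i. ?P i) \<in> sets torus"
        using A by (intro sets.countable_UN) (auto intro: measurable_sets[OF measurable_unit_phases])
      then show "set_integrable torus (\<Union>i. ?P i) h"
        unfolding set_integrable_def using ih by (intro integrable_mult_indicator)
    qed (use A union(1) in \<open>auto intro: measurable_sets[OF measurable_unit_phases] simp: disjoint_family_on_def\<close>)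
    also have "(\<Union>i. ?P i) = unit_phases -` (\<Union>i. A i) \<inter> space torus"
      by auto
    finally show ?case
      using union(3) by (simp add: eq)
  qed simp
qed

text \<open>
The inverse of \<open>cis\<close> on \<open>[0, 2\<pi>)\<close>. Clamping the real part keeps the argument of \<open>arccos\<close> in its
domain of continuity, which makes the function Borel measurable on the whole plane.
\<close>

definition torus_angle :: "complex \<Rightarrow> real" where
  "torus_angle z = (let a = arccos (max (- 1) (min 1 (Re z))) in if 0 \<le> Im z then a else 2 * pi - a)"

lemma measurable_torus_angle [measurable]: "torus_angle \<in> borel_measurable borel"
proof -
  have [measurable]: "(\<lambda>z. arccos (max (- 1) (min 1 (Re z)))) \<in> borel_measurable borel"
    by (intro borel_measurable_continuous_onI continuous_intros) auto
  show ?thesis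
    unfolding torus_angle_def Let_def by measurable
qed

lemma torus_angle_cis:
  assumes "0 \<le> t" "t < 2 * pi"
  shows "torus_angle (cis t) = t"
proof (cases "t \<le> pi")
  case True
  then show ?thesis
    using assms by (simp add: torus_angle_def sin_ge_zero arccos_cos)
next
  case False
  then have "sin t < 0"
    using assms by (intro sin_lt_zero) auto
  moreover have "arccos (cos t) = 2 * pi - t"
    using arccos_cos[of "2 * pi - t"] False assms by simp
  ultimately show ?thesis
    by (simp add: torus_angle_def)
qed

text \<open>
Recovering the angles from the phases is measurable, so every measurable subset of the cell is the
preimage of a Borel set of phases; hence \<open>h\<close> integrates to zero over every measurable set.
\<close>

theorem fourier_uniqueness:
  assumes h: "fourier_null h"
  shows "AE x in torus. h x = 0"
proof (rule sigma_finite_measure.density_zero)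
  interpret finite_measure torus
    by (rule finite_measure_torus)
  show "sigma_finite_measure torus"
    by unfold_locales
  show "integrable torus h"
    using h by (simp add: fourier_null_def)
  fix A :: "(real ^ 'a) set"
  assume A: "A \<in> sets torus"
  then have "A \<in> sets borel" and sub: "A \<subseteq> torus_cell"
    by (auto simp: torus_eq sets_restrict_space)
  define \<theta> :: "complex ^ 'a \<Rightarrow> real ^ 'a" where "\<theta> z = (\<chi> i. torus_angle (z $ i))" for z
  have [measurable]: "(\<lambda>z :: complex ^ 'a. z $ i) \<in> borel_measurable borel" for i
    by (intro borel_measurable_continuous_onI continuous_intros)
  have \<theta>: "\<theta> \<in> borel_measurable borel"
    by (subst borel_measurable_euclidean_space) (auto simp: \<theta>_def Basis_vec_def inner_axis)
  have "\<theta> (unit_phases x) = x" if "x \<in> torus_cell" for x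
    using that by (simp add: \<theta>_def vec_eq_iff torus_angle_cis torus_cell_def)
  then have "(indicator A x :: real) = indicator (\<theta> -` A) (unit_phases x)" if "x \<in> torus_cell" for x
    using that by (simp add: indicator_def)
  then have "(LINT x : A | torus. h x) = (\<integral>x. indicator (\<theta> -` A) (unit_phases x) *\<^sub>R h x \<partial>torus)"
    unfolding set_lebesgue_integral_def
    by (intro Bochner_Integration.integral_cong) (simp_all add: space_torus)
  also have "\<dots> = 0"
    using measurable_sets_borel[OF \<theta> \<open>A \<in> sets borel\<close>]
    by (rule integral_borel_fourier_null[OF h])
  finally show "(LINT x : A | torus. h x) = 0" .
qed


section \<open>Fourier coefficients of square integrable functions\<close>

definition period_volume :: "'d::finite itself \<Rightarrow> real" where
  "period_volume _ = (2 * pi) ^ CARD('d)"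

lemma period_volume_pos: "0 < period_volume TYPE('d::finite)"
  by (simp add: period_volume_def)

lemma square_integrable_fourier_mode: "square_integrable (fourier_mode n)"
proof -
  interpret finite_measure torus
    by (rule finite_measure_torus)
  show ?thesis
    by (simp add: square_integrable_def)
qed

lemma measure_torus: "measure (torus :: (real ^ 'd::finite) measure) (space torus) = period_volume TYPE('d)"
proof -
  interpret finite_measure "torus :: (real ^ 'd) measure"
    by (rule finite_measure_torus)
  have "complex_of_real (measure (torus :: (real ^ 'd) measure) (space torus))
      = (\<integral>x. fourier_mode (\<lambda>_. 0) x \<partial>(torus :: (real ^ 'd) measure))"
    by (simp add: fourier_mode_def scaleR_conv_of_real)
  also have "\<dots> = of_real (period_volume TYPE('d))"
    by (simp add: integral_fourier_mode period_volume_def)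
  finally show ?thesis
    by simp
qed

text \<open>
Without the factor \<open>(2\<pi>)\<^sup>-\<^sup>d\<close>, which reappears where a function is expanded in modes.
\<close>

lift_definition fourier_coefficient :: "'d::finite L2 \<Rightarrow> ('d \<Rightarrow> int) \<Rightarrow> complex" is
  "\<lambda>f n. \<integral>x. f x * cnj (fourier_mode n x) \<partial>torus"
proof -
  fix f f' :: "real ^ 'd \<Rightarrow> complex"
  assume *: "ae_equal f f'"
  then have [measurable]: "f \<in> borel_measurable torus" "f' \<in> borel_measurable torus"
    by (simp_all add: ae_equal_def square_integrable_def)
  have "AE x in torus. f x = f' x"
    using * by (simp add: ae_equal_def)
  then have "AE x in torus. f x * cnj (fourier_mode n x) = f' x * cnj (fourier_mode n x)" for n
    by eventually_elim simp
  then have "(\<integral>x. f x * cnj (fourier_mode n x) \<partial>torus) = (\<integral>x. f' x * cnj (fourier_mode n x) \<partial>torus)" for n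
    by (rule integral_cong_AE[rotated 2]) measurable
  then show "(\<lambda>n. \<integral>x. f x * cnj (fourier_mode n x) \<partial>torus)
      = (\<lambda>n. \<integral>x. f' x * cnj (fourier_mode n x) \<partial>torus)"
    by (rule ext)
qed

text \<open>
Subtracting from \<open>f\<close> its component along one mode lowers \<open>\<parallel>f\<parallel>\<^sup>2\<close> by the corresponding
coefficient square and leaves the other coefficients unchanged, so one can induct on the set of modes.
\<close>

lemma bessel_inequality_function:
  fixes f :: "real ^ 'd::finite \<Rightarrow> complex"
  assumes "finite F" "square_integrable f"
  shows "(\<Sum>n\<in>F. (norm (\<integral>x. f x * cnj (fourier_mode n x) \<partial>torus))\<^sup>2)
    \<le> period_volume TYPE('d) * (\<integral>x. (norm (f x))\<^sup>2 \<partial>torus)"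
  using assms
proof (induction F arbitrary: f rule: finite_induct)
  case empty
  show ?case
    using period_volume_pos[where 'd='d] by simp
next
  case (insert m F)
  interpret finite_measure "torus :: (real ^ 'd) measure"
    by (rule finite_measure_torus)
  define L where "L = period_volume TYPE('d)"
  have L: "0 < L"
    by (simp add: L_def period_volume_pos)
  define c where "c = (\<integral>x. f x * cnj (fourier_mode m x) \<partial>torus)"
  \<comment> \<open>The modes have squared norm \<open>L\<close>, so \<open>a\<close> is the coefficient of the orthogonal projection.\<close>
  define a where "a = c / of_real L"
  define f' where "f' x = f x - a * fourier_mode m x" for x
  have f': "square_integrable f'"
    unfolding f'_def
    by (intro square_integrable_diff square_integrable_scale square_integrable_fourier_mode insert.prems)
  have int: "integrable torus (\<lambda>x. f x * cnj (fourier_mode n x))" for n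
    by (intro square_integrable_mult square_integrable_fourier_mode insert.prems)
  have modes: "integrable torus (\<lambda>x. fourier_mode m x * cnj (fourier_mode n x))" for n :: "'d \<Rightarrow> int"
    by (intro square_integrable_mult square_integrable_fourier_mode)
  have coeff: "(\<integral>x. f' x * cnj (fourier_mode n x) \<partial>torus) = (\<integral>x. f x * cnj (fourier_mode n x) \<partial>torus)"
    if "n \<in> F" for n
  proof -
    have "m \<noteq> n"
      using that insert.hyps by auto
    have "(\<integral>x. f' x * cnj (fourier_mode n x) \<partial>torus)
        = (\<integral>x. f x * cnj (fourier_mode n x) - a * (fourier_mode m x * cnj (fourier_mode n x)) \<partial>torus)"
      by (simp add: f'_def algebra_simps)
    also have "\<dots> = (\<integral>x. f x * cnj (fourier_mode n x) \<partial>torus)"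
      using \<open>m \<noteq> n\<close> by (simp add: int modes fourier_mode_orthogonal)
    finally show ?thesis .
  qed
  have pointwise: "(norm (f' x))\<^sup>2 = (norm (f x))\<^sup>2 - 2 * Re (cnj a * (f x * cnj (fourier_mode m x))) + (norm a)\<^sup>2" for x
  proof -
    have "(norm (w - a * e))\<^sup>2 = (norm w)\<^sup>2 - 2 * Re (cnj a * (w * cnj e)) + (norm a)\<^sup>2 * (norm e)\<^sup>2" for w e
      unfolding cmod_power2 by (simp add: algebra_simps power2_eq_square)
    from this[of "f x" "fourier_mode m x"] show ?thesis
      by (simp add: f'_def)
  qed
  have "(\<integral>x. (norm (f' x))\<^sup>2 \<partial>torus) = (\<integral>x. (norm (f x))\<^sup>2 \<partial>torus) - 2 * Re (cnj a * c) + (norm a)\<^sup>2 * L"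
  proof -
    have "integrable torus (\<lambda>x. (norm (f x))\<^sup>2)"
      using insert.prems by (simp add: square_integrable_def)
    moreover define r where "r x = Re (cnj a * (f x * cnj (fourier_mode m x)))" for x
    moreover have "integrable torus r" "(\<integral>x. r x \<partial>torus) = Re (cnj a * c)"
      unfolding r_def c_def using int[of m] by (simp_all only: integrable_Re integrable_mult_right
          integral_Re Bochner_Integration.integral_mult_right_zero)
    ultimately show ?thesis
      by (simp only: pointwise flip: r_def) (simp add: measure_torus L_def)
  qed
  also have "Re (cnj a * c) = (norm c)\<^sup>2 / L"
    unfolding a_def cmod_power2 by (simp add: power2_eq_square add_divide_distrib)
  also have "(norm a)\<^sup>2 * L = (norm c)\<^sup>2 / L"
    using L by (simp add: a_def norm_divide power_divide power2_eq_square)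
  finally have f'_norm: "L * (\<integral>x. (norm (f' x))\<^sup>2 \<partial>torus) = L * (\<integral>x. (norm (f x))\<^sup>2 \<partial>torus) - (norm c)\<^sup>2"
    using L by (simp add: field_simps)
  have "(\<Sum>n\<in>F. (norm (\<integral>x. f x * cnj (fourier_mode n x) \<partial>torus))\<^sup>2)
      = (\<Sum>n\<in>F. (norm (\<integral>x. f' x * cnj (fourier_mode n x) \<partial>torus))\<^sup>2)"
    by (simp add: coeff)
  also have "\<dots> \<le> L * (\<integral>x. (norm (f' x))\<^sup>2 \<partial>torus)"
    unfolding L_def by (rule insert.IH[OF f'])
  finally show ?case
    using insert.hyps f'_norm by (simp add: c_def L_def)
qed

lemma bessel_inequality:
  fixes u :: "'d::finite L2"
  assumes "finite F"
  shows "(\<Sum>n\<in>F. (norm (fourier_coefficient u n))\<^sup>2) \<le> period_volume TYPE('d) * mass u"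
  using assms by transfer (simp add: bessel_inequality_function ae_equal_def)

lemma fourier_mode_has_derivative:
  "((\<lambda>x. c * fourier_mode n x) has_derivative
    (\<lambda>y. c * (fourier_mode n x * (\<i> * of_real (\<Sum>i\<in>UNIV. of_int (n i) * y $ i))))) (at x)"
proof -
  have "((\<lambda>x. \<Sum>i\<in>UNIV. of_int (n i) * x $ i) has_derivative (\<lambda>y. \<Sum>i\<in>UNIV. of_int (n i) * y $ i)) (at x)"
    by (intro has_derivative_sum has_derivative_mult_right bounded_linear_imp_has_derivative
        bounded_linear_vec_nth)
  then have "((\<lambda>x. \<i> * of_real (\<Sum>i\<in>UNIV. of_int (n i) * x $ i)) has_derivative
      (\<lambda>y. \<i> * of_real (\<Sum>i\<in>UNIV. of_int (n i) * y $ i))) (at x)"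
    by (intro has_derivative_mult_right has_derivative_of_real)
  from has_derivative_compose[OF this has_field_derivative_imp_has_derivative[OF DERIV_exp]] show ?thesis
    unfolding fourier_mode_def cis_conv_exp by (rule has_derivative_mult_right)
qed

lemma partial_derivative_fourier_mode:
  "partial_derivative i (\<lambda>x. c * fourier_mode n x) = (\<lambda>x. (\<i> * of_int (n i) * c) * fourier_mode n x)"
proof
  fix x :: "real ^ 'a"
  have "(\<Sum>j\<in>UNIV. of_int (n j) * axis i (1 :: real) $ j) = of_int (n i)"
    by (simp add: axis_def if_distrib cong: if_cong)
  then show "partial_derivative i (\<lambda>x. c * fourier_mode n x) x = (\<i> * of_int (n i) * c) * fourier_mode n x"
    unfolding partial_derivative_def
    by (simp add: frechet_derivative_at[OF fourier_mode_has_derivative, symmetric] mult_ac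
        del: of_real_sum)
qed

lemma partial_derivatives_fourier_mode:
  "partial_derivatives is (fourier_mode n) = (\<lambda>x. (\<Prod>i\<leftarrow>is. \<i> * of_int (n i)) * fourier_mode n x)"
  by (induction "is") (simp_all add: partial_derivatives_def partial_derivative_fourier_mode mult.assoc)

lemma test_function_fourier_mode: "test_function (fourier_mode n)"
proof -
  have "(\<lambda>x. c * fourier_mode n x) differentiable (at x)" for c x
    using fourier_mode_has_derivative by (auto simp: differentiable_def)
  moreover have "fourier_mode n (x + axis i (2 * pi)) = fourier_mode n x" for i x
  proof -
    have "(\<Sum>j\<in>UNIV. of_int (n j) * (x + axis i (2 * pi)) $ j)
        = (\<Sum>j\<in>UNIV. of_int (n j) * x $ j) + 2 * pi * of_int (n i)"
    proof -
      have "(\<Sum>j\<in>UNIV. of_int (n j) * axis i (2 * pi) $ j) = 2 * pi * of_int (n i)"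
        by (simp add: axis_def if_distrib mult_ac cong: if_cong)
      then show ?thesis
        by (simp only: vector_add_component distrib_left sum.distrib)
    qed
    then show ?thesis
      unfolding fourier_mode_def by (simp add: cis_mult[symmetric] cis_multiple_2pi)
  qed
  ultimately show ?thesis
    by (simp add: test_function_def partial_derivatives_fourier_mode)
qed

text \<open>
The mode conjugate to \<open>n\<close> is itself a test function, and each derivative multiplies it by
\<open>- \<i> n\<^sub>i\<close>; the sign is absorbed by the one in the definition of weak derivatives.
\<close>

lemma fourier_coefficient_weak_derivative:
  "has_weak_derivative u is v \<Longrightarrow>
    fourier_coefficient v n = (\<Prod>i\<leftarrow>is. \<i> * of_int (n i)) * fourier_coefficient u n"
proof (transfer fixing: "is" n)
  fix f g :: "real ^ 'a \<Rightarrow> complex"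
  let ?\<phi> = "fourier_mode (\<lambda>i. - n i)"
  assume "\<forall>\<phi>. test_function \<phi> \<longrightarrow>
     (\<integral>x. f x * partial_derivatives is \<phi> x \<partial>torus) = (-1) ^ length is * (\<integral>x. g x * \<phi> x \<partial>torus)"
  then have "(\<integral>x. f x * partial_derivatives is ?\<phi> x \<partial>torus) = (-1) ^ length is * (\<integral>x. g x * ?\<phi> x \<partial>torus)"
    by (simp add: test_function_fourier_mode)
  moreover have "(\<integral>x. f x * partial_derivatives is ?\<phi> x \<partial>torus)
      = (\<Prod>i\<leftarrow>is. - (\<i> * of_int (n i))) * (\<integral>x. f x * ?\<phi> x \<partial>torus)"
    unfolding partial_derivatives_fourier_mode mult.left_commute[of "f _"] by simp
  moreover have "(\<Prod>i\<leftarrow>is. - (\<i> * of_int (n i))) = (-1) ^ length is * (\<Prod>i\<leftarrow>is. \<i> * of_int (n i))"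
    by (induction "is") simp_all
  ultimately have "(-1) ^ length is * ((\<Prod>i\<leftarrow>is. \<i> * of_int (n i)) * (\<integral>x. f x * ?\<phi> x \<partial>torus))
      = (-1) ^ length is * (\<integral>x. g x * ?\<phi> x \<partial>torus)"
    by (simp add: mult.assoc)
  then show "(\<integral>x. g x * cnj (fourier_mode n x) \<partial>torus)
      = (\<Prod>i\<leftarrow>is. \<i> * of_int (n i)) * (\<integral>x. f x * cnj (fourier_mode n x) \<partial>torus)"
    by (simp add: cnj_fourier_mode)
qed


section \<open>The Sobolev embedding into bounded functions\<close>

lift_definition essentially_bounded :: "real \<Rightarrow> 'd::finite L2 \<Rightarrow> bool" is
  "\<lambda>B f. AE x in torus. norm (f x) \<le> B"
proof -
  fix B :: real and f g :: "real ^ 'd \<Rightarrow> complex"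
  assume "ae_equal f g"
  then have "AE x in torus. f x = g x"
    by (simp add: ae_equal_def)
  then have "AE x in torus. norm (f x) \<le> B \<longleftrightarrow> norm (g x) \<le> B"
    by eventually_elim simp
  then show "(AE x in torus. norm (f x) \<le> B) = (AE x in torus. norm (g x) \<le> B)"
    by (rule eventually_subst)
qed

lemma infinite_UNIV_frequencies: "infinite (UNIV :: ('d::finite \<Rightarrow> int) set)"
proof
  assume "finite (UNIV :: ('d \<Rightarrow> int) set)"
  then have "finite ((\<lambda>n :: 'd \<Rightarrow> int. n undefined) ` UNIV)"
    by (rule finite_imageI)
  moreover have "(\<lambda>n :: 'd \<Rightarrow> int. n undefined) ` UNIV = UNIV"
    by (auto intro!: image_eqI[of _ _ "\<lambda>_. x" for x])
  ultimately show False
    by (simp add: infinite_UNIV_int)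
qed

text \<open>
The Fourier series of \<open>f\<close> converges absolutely and uniformly to a function bounded by the sum of the moduli
of its terms. That function has the coefficients of \<open>f\<close>, hence equals \<open>f\<close> almost
everywhere.
\<close>

lemma AE_bounded_if_fourier_summable:
  fixes f :: "real ^ 'd::finite \<Rightarrow> complex"
  assumes f: "square_integrable f"
    and K: "\<And>F. finite F \<Longrightarrow> (\<Sum>n\<in>F. norm (\<integral>x. f x * cnj (fourier_mode n x) \<partial>torus)) \<le> K"
  shows "AE x in torus. norm (f x) \<le> K / period_volume TYPE('d)"
proof -
  interpret finite_measure "torus :: (real ^ 'd) measure"
    by (rule finite_measure_torus)
  define L where "L = period_volume TYPE('d)"
  have L: "0 < L"
    by (simp add: L_def period_volume_pos)
  define c where "c n = (\<integral>x. f x * cnj (fourier_mode n x) \<partial>torus)" for n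
  obtain b :: "nat \<Rightarrow> 'd \<Rightarrow> int" where b: "bij b"
    using bij_betw_from_nat_into[OF countableI_type infinite_UNIV_frequencies] by blast
  define g where "g k x = c (b k) / of_real L * fourier_mode (b k) x" for k x
  have norm_g: "norm (g k x) = norm (c (b k)) / L" for k x
    using L by (simp add: g_def norm_mult norm_divide)
  have partial: "(\<Sum>k<N. norm (c (b k))) \<le> K" for N
  proof -
    have "(\<Sum>k<N. norm (c (b k))) = (\<Sum>n\<in>b ` {..<N}. norm (c n))"
      using b by (subst sum.reindex) (auto intro: inj_on_subset bij_is_inj)
    also have "\<dots> \<le> K"
      unfolding c_def by (rule K) simp
    finally show ?thesis .
  qed
  have sum_c: "summable (\<lambda>k. norm (c (b k)))"
    by (rule bounded_imp_summable[of _ K]) (use partial[of "Suc _"] in \<open>auto simp: lessThan_Suc_atMost\<close>)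
  then have sum_g: "summable (\<lambda>k. norm (g k x))" for x
    by (simp add: norm_g summable_divide)
  have bound_g: "norm (\<Sum>k. g k x) \<le> K / L" for x
  proof -
    have "norm (\<Sum>k. g k x) \<le> (\<Sum>k. norm (g k x))"
      by (rule summable_norm[OF sum_g])
    also have "\<dots> = (\<Sum>k. norm (c (b k))) / L"
      by (simp add: norm_g suminf_divide[OF sum_c])
    also have "\<dots> \<le> K / L"
      using L by (intro divide_right_mono suminf_le_const sum_c partial) auto
    finally show ?thesis .
  qed
  have [measurable]: "g k \<in> borel_measurable torus" for k
    unfolding g_def by measurable
  have [measurable]: "f \<in> borel_measurable torus"
    using f by (rule square_integrable_measurable)
  have int_sum: "integrable torus (\<lambda>x. \<Sum>k. g k x)"
    by (rule integrable_const_bound[of _ "K / L"]) (use bound_g in auto)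
  have int_f: "integrable torus f"
    using square_integrable_mult[OF f square_integrable_fourier_mode[of "\<lambda>_. 0"]]
    by (simp add: fourier_mode_def)
  have "fourier_null (\<lambda>x. f x - (\<Sum>k. g k x))"
    unfolding fourier_null_def
  proof (intro conjI allI)
    show "integrable torus (\<lambda>x. f x - (\<Sum>k. g k x))"
      using int_f int_sum by simp
    fix m :: "'d \<Rightarrow> int"
    define n where "n = (\<lambda>i. - m i)"
    have m: "fourier_mode m x = cnj (fourier_mode n x)" for x
      by (simp add: cnj_fourier_mode n_def)
    obtain k0 where k0: "b k0 = n"
      using b by (metis bij_pointE)
    have each: "(\<integral>x. fourier_mode m x * g k x \<partial>torus) = (if k = k0 then c n else 0)" for k
    proof -
      have "(\<integral>x. fourier_mode m x * g k x \<partial>torus)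
          = (\<integral>x. c (b k) / of_real L * (fourier_mode (b k) x * cnj (fourier_mode n x)) \<partial>torus)"
        by (simp add: g_def m mult_ac)
      also have "\<dots> = c (b k) / of_real L * (if b k = n then L else 0)"
        by (simp add: fourier_mode_orthogonal L_def period_volume_def)
      also have "\<dots> = (if k = k0 then c n else 0)"
        using L k0 b by (auto simp: bij_def inj_def)
      finally show ?thesis .
    qed
    have int_each: "integrable torus (\<lambda>x. fourier_mode m x * g k x)" for k
      by (rule integrable_const_bound[of _ "norm (c (b k)) / L"]) (auto simp: norm_mult norm_g)
    have "(\<integral>x. fourier_mode m x * (\<Sum>k. g k x) \<partial>torus) = (\<integral>x. (\<Sum>k. fourier_mode m x * g k x) \<partial>torus)"
      using sum_g by (simp add: suminf_mult summable_norm_cancel)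
    also have "\<dots> = (\<Sum>k. \<integral>x. fourier_mode m x * g k x \<partial>torus)"
    proof (rule integral_suminf[OF int_each])
      show "AE x in torus. summable (\<lambda>k. norm (fourier_mode m x * g k x))"
        using sum_g by (simp add: norm_mult)
      show "summable (\<lambda>k. \<integral>x. norm (fourier_mode m x * g k x) \<partial>torus)"
        using sum_c by (simp add: norm_mult norm_g summable_divide summable_mult)
    qed
    also have "\<dots> = c n"
      unfolding each by (subst suminf_finite[of "{k0}"]) auto
    finally have "(\<integral>x. fourier_mode m x * (\<Sum>k. g k x) \<partial>torus) = c n" .
    moreover have "(\<integral>x. fourier_mode m x * f x \<partial>torus) = c n"
      by (simp add: c_def m mult.commute)
    ultimately show "(\<integral>x. fourier_mode m x * (f x - (\<Sum>k. g k x)) \<partial>torus) = 0"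
      using integrable_fourier_mode_mult[OF int_f] integrable_fourier_mode_mult[OF int_sum]
      by (simp add: right_diff_distrib)
  qed
  from fourier_uniqueness[OF this] show ?thesis
    unfolding L_def[symmetric] by eventually_elim (metis bound_g eq_iff_diff_eq_0)
qed

lemma essentially_bounded_if_absolutely_summable:
  fixes u :: "'d::finite L2"
  assumes "\<And>F. finite F \<Longrightarrow> (\<Sum>n\<in>F. norm (fourier_coefficient u n)) \<le> K"
  shows "essentially_bounded (K / period_volume TYPE('d)) u"
  using assms
proof transfer
  fix f :: "real ^ 'd \<Rightarrow> complex" and K
  assume "ae_equal f f"
    "\<And>F. finite F \<Longrightarrow> (\<Sum>n\<in>F. norm (\<integral>x. f x * cnj (fourier_mode n x) \<partial>torus)) \<le> K"
  then show "AE x in torus. norm (f x) \<le> K / period_volume TYPE('d)"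
    by (intro AE_bounded_if_fourier_summable) (auto simp: ae_equal_def)
qed

lemma summable_quartic_weights: "summable (\<lambda>k :: nat. (1 + real k ^ 4) powr (- 1 / 3))"
proof (rule summable_comparison_test_ev)
  show "summable (\<lambda>k :: nat. real k powr (- 4 / 3))"
    by (simp add: summable_real_powr_iff)
  show "\<forall>\<^sub>F k :: nat in sequentially. norm ((1 + real k ^ 4) powr (- 1 / 3)) \<le> real k powr (- 4 / 3)"
    using eventually_gt_at_top[of 0]
  proof eventually_elim
    case (elim k)
    then have "(1 + real k ^ 4) powr (- 1 / 3) \<le> (real k ^ 4) powr (- 1 / 3)"
      by (intro powr_mono2') auto
    also have "\<dots> = real k powr (- 4 / 3)"
      using elim powr_realpow[of "real k" 4, symmetric] by (simp only: powr_powr) simp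
    finally show ?case
      by simp
  qed
qed

text \<open>
Every factor \<open>1 + n\<^sub>i\<^sup>4\<close> is at most \<open>w = 1 + \<Sum>\<^sub>i n\<^sub>i\<^sup>4\<close>, so \<open>\<Prod>\<^sub>i (1 + n\<^sub>i\<^sup>4)\<^sup>-\<^sup>1\<^sup>/\<^sup>3\<close> is at least
\<open>w\<^sup>-\<^sup>d\<^sup>/\<^sup>3\<close>, which is at least \<open>1/w\<close> because \<open>d \<le> 3\<close>. The sum of the products over a box factorises
into sums in one variable, and these converge since \<open>4/3 > 1\<close>.
\<close>

lemma quartic_weight_sum_bounded:
  assumes "CARD('d::finite) \<in> {1, 2, 3}"
  shows "\<exists>C. \<forall>F. finite F \<longrightarrow> (\<Sum>n\<in>F. 1 / (1 + (\<Sum>i\<in>UNIV. of_int (n (i :: 'd)) ^ 4))) \<le> (C :: real)"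
proof -
  define s :: "int \<Rightarrow> real" where "s k = (1 + of_int k ^ 4) powr (- 1 / 3)" for k :: int
  define A where "A = (\<Sum>k. (1 + real k ^ 4) powr (- 1 / 3))"
  have s_nonneg: "0 \<le> s k" for k
    by (simp add: s_def)
  have half: "(\<Sum>k\<le>m. s (int k)) \<le> A" for m
    unfolding A_def s_def using summable_quartic_weights
    by (intro order_trans[OF _ sum_le_suminf[of _ "{..m}"]]) auto
  have line: "(\<Sum>k\<in>{- int m..int m}. s k) \<le> 2 * A" for m
  proof -
    have "{- int m..int m} \<subseteq> int ` {..m} \<union> (\<lambda>k. - int k) ` {..m}"
    proof
      fix k
      assume k: "k \<in> {- int m..int m}"
      show "k \<in> int ` {..m} \<union> (\<lambda>k. - int k) ` {..m}"
        by (cases k rule: int_cases2) (use k in auto)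
    qed
    then have "(\<Sum>k\<in>{- int m..int m}. s k) \<le> (\<Sum>k\<in>int ` {..m} \<union> (\<lambda>k. - int k) ` {..m}. s k)"
      by (intro sum_mono2) (auto simp: s_nonneg)
    also have "\<dots> \<le> (\<Sum>k\<in>int ` {..m}. s k) + (\<Sum>k\<in>(\<lambda>k. - int k) ` {..m}. s k)"
      by (subst sum_Un) (auto simp: s_nonneg sum_nonneg)
    also have "\<dots> = (\<Sum>k\<le>m. s (int k)) + (\<Sum>k\<le>m. s (int k))"
      by (simp add: sum.reindex inj_on_def s_def)
    finally show ?thesis
      using half[of m] by simp
  qed
  have weight: "1 / (1 + (\<Sum>i\<in>UNIV. of_int (n i) ^ 4)) \<le> (\<Prod>i\<in>UNIV. s (n i))" for n :: "'d \<Rightarrow> int"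
  proof -
    define w :: real where "w = 1 + (\<Sum>i\<in>UNIV. of_int (n i) ^ 4)"
    have w: "1 \<le> w"
      by (simp add: w_def sum_nonneg)
    have "w powr (- 1 / 3) \<le> s (n i)" for i
      unfolding s_def w_def
      by (intro powr_mono2') (auto intro!: member_le_sum add_pos_nonneg)
    then have "(\<Prod>i\<in>(UNIV :: 'd set). w powr (- 1 / 3)) \<le> (\<Prod>i\<in>UNIV. s (n i))"
      by (intro prod_mono) auto
    moreover have "1 / w \<le> (\<Prod>i\<in>(UNIV :: 'd set). w powr (- 1 / 3))"
    proof -
      have "1 / w = w powr (- 1)"
        using w by (simp add: powr_minus_divide)
      also have "\<dots> \<le> w powr (real CARD('d) * (- 1 / 3))"
        using w assms by (intro powr_mono) auto
      also have "\<dots> = (\<Prod>i\<in>(UNIV :: 'd set). w powr (- 1 / 3))"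
        using w by (simp add: powr_power mult.commute)
      finally show ?thesis .
    qed
    ultimately show ?thesis
      by (simp add: w_def)
  qed
  have "(\<Sum>n\<in>F. 1 / (1 + (\<Sum>i\<in>UNIV. of_int (n i) ^ 4))) \<le> (2 * A) ^ CARD('d)"
    if F: "finite F" for F :: "('d \<Rightarrow> int) set"
  proof -
    have "finite ((\<lambda>(n, i). nat \<bar>n i\<bar>) ` (F \<times> (UNIV :: 'd set)))"
      using F by simp
    then obtain m where "\<forall>k \<in> (\<lambda>(n, i). nat \<bar>n i\<bar>) ` (F \<times> (UNIV :: 'd set)). k \<le> m"
      unfolding finite_nat_set_iff_bounded_le by blast
    then have m: "nat \<bar>n i\<bar> \<le> m" if "n \<in> F" for n i
      using that by force
    have "F \<subseteq> PiE UNIV (\<lambda>_. {- int m..int m})"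
    proof
      fix n
      assume "n \<in> F"
      then have "\<bar>n i\<bar> \<le> int m" for i
        using m[of n i] by simp
      then show "n \<in> PiE UNIV (\<lambda>_. {- int m..int m})"
        by (auto simp: abs_le_iff minus_le_iff)
    qed
    then have "(\<Sum>n\<in>F. \<Prod>i\<in>UNIV. s (n i)) \<le> (\<Sum>n\<in>PiE (UNIV :: 'd set) (\<lambda>_. {- int m..int m}). \<Prod>i\<in>UNIV. s (n i))"
      by (intro sum_mono2) (auto intro!: finite_PiE prod_nonneg s_nonneg)
    also have "\<dots> = (\<Prod>i\<in>(UNIV :: 'd set). \<Sum>k\<in>{- int m..int m}. s k)"
      by (rule prod_sum_PiE[symmetric]) auto
    also have "\<dots> \<le> (2 * A) ^ CARD('d)"
      using line[of m] unfolding prod_constant by (intro power_mono sum_nonneg s_nonneg)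
    finally show ?thesis
      by (rule order_trans[OF sum_mono[OF weight]])
  qed
  then show ?thesis
    by blast
qed

text \<open>
The pure second derivatives suffice: with \<open>w\<^sub>n = 1 + \<Sum>\<^sub>i n\<^sub>i\<^sup>4\<close>, Bessel's inequality for \<open>V\<close> and
\<open>\<partial>\<^sub>i\<partial>\<^sub>i V\<close> bounds \<open>\<Sum> w\<^sub>n \<bar>c\<^sub>n\<bar>\<^sup>2\<close>, and \<open>\<bar>c\<^sub>n\<bar> \<le> 1/w\<^sub>n + w\<^sub>n \<bar>c\<^sub>n\<bar>\<^sup>2\<close> turns this into
absolute summability.
\<close>

theorem H2_essentially_bounded:
  fixes V :: "'d::finite L2"
  assumes dim: "CARD('d) \<in> {1, 2, 3}" and V: "V \<in> H2"
  shows "\<exists>B\<ge>0. essentially_bounded B V"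
proof -
  define L where "L = period_volume TYPE('d)"
  have "\<forall>i. \<exists>g. has_weak_derivative V [i, i] g"
    using V by (simp add: H2_def)
  then obtain g where g: "\<And>i. has_weak_derivative V [i, i] (g i)"
    by metis
  obtain C where C: "\<And>F :: ('d \<Rightarrow> int) set. finite F \<Longrightarrow>
      (\<Sum>n\<in>F. 1 / (1 + (\<Sum>i\<in>UNIV. of_int (n i) ^ 4))) \<le> (C :: real)"
    using quartic_weight_sum_bounded[OF dim] by blast
  define D where "D = L * mass V + (\<Sum>i\<in>UNIV. L * mass (g i))"
  have "(\<Sum>n\<in>F. norm (fourier_coefficient V n)) \<le> C + D" if F: "finite F" for F
  proof -
    define w :: "('d \<Rightarrow> int) \<Rightarrow> real" where "w n = 1 + (\<Sum>i\<in>UNIV. of_int (n i) ^ 4)" for n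
    have w: "0 < w n" for n
      by (simp add: w_def sum_nonneg add_pos_nonneg)
    have coeff: "of_int (n i) ^ 4 * (norm (fourier_coefficient V n))\<^sup>2 = (norm (fourier_coefficient (g i) n))\<^sup>2" for n i
      by (simp add: fourier_coefficient_weak_derivative[OF g] norm_mult power_mult_distrib eval_nat_numeral)
    have "(\<Sum>n\<in>F. w n * (norm (fourier_coefficient V n))\<^sup>2)
        = (\<Sum>n\<in>F. (norm (fourier_coefficient V n))\<^sup>2) + (\<Sum>i\<in>UNIV. \<Sum>n\<in>F. (norm (fourier_coefficient (g i) n))\<^sup>2)"
      by (subst sum.swap) (simp add: w_def distrib_right sum_distrib_right coeff sum.distrib)
    also have "\<dots> \<le> D"
      unfolding D_def L_def using F by (intro add_mono sum_mono bessel_inequality)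
    finally have D: "(\<Sum>n\<in>F. w n * (norm (fourier_coefficient V n))\<^sup>2) \<le> D" .
    have "a \<le> 1 / v + v * a\<^sup>2" if "0 < v" "0 \<le> a" for a v :: real
    proof -
      \<comment> \<open>In other words, \<open>v a \<le> 1 + (v a)\<^sup>2\<close>.\<close>
      have "0 \<le> (1 - v * a)\<^sup>2 + v * a"
        using that by simp
      then have "v * a \<le> v * (1 / v + v * a\<^sup>2)"
        using that by (simp add: power2_eq_square algebra_simps)
      then show ?thesis
        using that by simp
    qed
    then have "(\<Sum>n\<in>F. norm (fourier_coefficient V n))
        \<le> (\<Sum>n\<in>F. 1 / w n + w n * (norm (fourier_coefficient V n))\<^sup>2)"
      by (intro sum_mono) (simp add: w)
    also have "\<dots> \<le> C + D"
      using C[OF F] D by (simp add: sum.distrib w_def)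
    finally show ?thesis .
  qed
  note bound = this
  have "0 \<le> C + D"
    using bound[of "{}"] by simp
  then show ?thesis
    using essentially_bounded_if_absolutely_summable[OF bound] period_volume_pos[where 'd='d]
    by (intro exI[of _ "(C + D) / period_volume TYPE('d)"]) simp
qed


section \<open>Expansion in an orthonormal basis\<close>

definition fourier_partial_sum :: "(nat \<Rightarrow> 'a::real_inner) \<Rightarrow> nat \<Rightarrow> 'a \<Rightarrow> 'a" where
  "fourier_partial_sum e n u = (\<Sum>j<n. inner u (e j) *\<^sub>R e j)"

lemma inner_fourier_partial_sum:
  "inner (fourier_partial_sum e n u) v = (\<Sum>j<n. inner u (e j) * inner v (e j))"
  by (simp add: fourier_partial_sum_def inner_sum_left inner_commute[of v])

lemma inner_fourier_partial_sum_basis: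
  assumes "orthonormal_basis e"
  shows "inner (fourier_partial_sum e n u) (e k) = (if k < n then inner u (e k) else 0)"
proof -
  have on: "inner (e i) (e j) = (if i = j then 1 else 0)" for i j
    using assms by (auto simp: orthonormal_basis_def)
  show ?thesis
    by (simp add: inner_fourier_partial_sum on if_distrib cong: if_cong)
qed

lemma norm_fourier_partial_sum_square:
  assumes "orthonormal_basis e"
  shows "inner (fourier_partial_sum e n u) (fourier_partial_sum e n u) = inner u (fourier_partial_sum e n u)"
proof -
  have "inner (fourier_partial_sum e n u) (fourier_partial_sum e n u)
      = (\<Sum>j<n. inner u (e j) * inner u (e j))"
    unfolding inner_fourier_partial_sum[of e n u "fourier_partial_sum e n u"]
    by (simp add: inner_fourier_partial_sum_basis[OF assms])
  then show ?thesis
    by (simp add: inner_fourier_partial_sum inner_commute[of u "fourier_partial_sum e n u"])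
qed

lemma norm_fourier_remainder_le:
  assumes "orthonormal_basis e"
  shows "norm (u - fourier_partial_sum e n u) \<le> norm u"
proof -
  have "inner (u - fourier_partial_sum e n u) (u - fourier_partial_sum e n u)
      = inner u u - inner (fourier_partial_sum e n u) (fourier_partial_sum e n u)"
    using norm_fourier_partial_sum_square[OF assms, of n u]
    by (simp add: inner_diff_left inner_diff_right inner_commute)
  also have "\<dots> \<le> inner u u"
    by simp
  finally show ?thesis
    by (simp add: norm_le)
qed

lemma norm_fourier_partial_sum_le:
  assumes "orthonormal_basis e"
  shows "norm (fourier_partial_sum e n u) \<le> norm u"
proof -
  have "norm (fourier_partial_sum e n u) ^ 2 \<le> norm u * norm (fourier_partial_sum e n u)"
    using norm_fourier_partial_sum_square[OF assms, of n u] norm_cauchy_schwarz[of u "fourier_partial_sum e n u"]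
    by (simp add: power2_norm_eq_inner)
  then show ?thesis
    by (cases "fourier_partial_sum e n u = 0") (auto simp: power2_eq_square)
qed

lemma fourier_partial_sum_diff:
  "fourier_partial_sum e n (u - v) = fourier_partial_sum e n u - fourier_partial_sum e n v"
  by (simp add: fourier_partial_sum_def inner_diff_left scaleR_diff_left sum_subtractf)

lemma fourier_partial_sum_eventually_exact:
  assumes e: "orthonormal_basis e" and y: "y \<in> span (range e)"
  shows "\<forall>\<^sub>F n in sequentially. fourier_partial_sum e n y = y"
  using y
proof (induction rule: span_induct_alt)
  case base
  show ?case
    by (simp add: fourier_partial_sum_def)
next
  case (step c x z)
  then obtain k where x: "x = e k"
    by auto
  have on: "inner (e i) (e j) = (if i = j then 1 else 0)" for i j
    using e by (auto simp: orthonormal_basis_def)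
  from step(2) eventually_gt_at_top[of k] show ?case
  proof eventually_elim
    case (elim n)
    have "fourier_partial_sum e n (c *\<^sub>R x + z) = c *\<^sub>R fourier_partial_sum e n x + fourier_partial_sum e n z"
      by (simp add: fourier_partial_sum_def inner_add_left scaleR_add_left sum.distrib scaleR_sum_right)
    moreover have "fourier_partial_sum e n x = x"
      using elim(2) by (simp add: fourier_partial_sum_def x on if_distrib if_distribR cong: if_cong)
    ultimately show ?case
      using elim(1) by simp
  qed
qed

text \<open>
The partial sums are exact on each finite combination of basis vectors from some index on, these
combinations are dense, and the remainder operators are contractions.
\<close>

lemma fourier_partial_sum_tendsto:
  assumes "orthonormal_basis e"
  shows "(\<lambda>n. fourier_partial_sum e n u) \<longlonglongrightarrow> u"
proof (rule tendstoI)
  fix \<epsilon> :: real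
  assume "0 < \<epsilon>"
  have "u \<in> closure (span (range e))"
    using assms by (simp add: orthonormal_basis_def)
  then obtain y where y: "y \<in> span (range e)" "dist y u < \<epsilon>"
    using \<open>0 < \<epsilon>\<close> unfolding closure_approachable by blast
  from fourier_partial_sum_eventually_exact[OF assms y(1)]
  show "\<forall>\<^sub>F n in sequentially. dist (fourier_partial_sum e n u) u < \<epsilon>"
  proof eventually_elim
    case (elim n)
    have eq: "u - fourier_partial_sum e n u = (u - y) - fourier_partial_sum e n (u - y)"
      by (simp add: fourier_partial_sum_diff elim)
    have "norm (u - fourier_partial_sum e n u) \<le> norm (u - y)"
      unfolding eq by (rule norm_fourier_remainder_le[OF assms])
    then show ?case
      using y(2) by (simp add: dist_norm norm_minus_commute)
  qed
qed

lemma parseval_inner: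
  assumes "orthonormal_basis e"
  shows "(\<lambda>j. inner u (e j) * inner v (e j)) sums inner u v"
  unfolding sums_def inner_fourier_partial_sum[symmetric]
  by (intro tendsto_inner fourier_partial_sum_tendsto[OF assms] tendsto_const)


section \<open>Measurability through scalar products\<close>

text \<open>
For a space that is not known to be second countable, sums of Borel measurable functions need not
obviously be Borel measurable; for this notion closure under sums is immediate.
\<close>

definition weakly_measurable :: "'w measure \<Rightarrow> ('w \<Rightarrow> 'a::real_inner) \<Rightarrow> bool" where
  "weakly_measurable G X \<longleftrightarrow> (\<forall>v. (\<lambda>\<omega>. inner (X \<omega>) v) \<in> borel_measurable G)"

lemma weakly_measurableD [measurable_dest]:
  "weakly_measurable G X \<Longrightarrow> (\<lambda>\<omega>. inner (X \<omega>) v) \<in> borel_measurable G"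
  by (simp add: weakly_measurable_def)

lemma weakly_measurable_if_borel:
  fixes X :: "'w \<Rightarrow> 'a::real_inner"
  assumes "X \<in> borel_measurable G"
  shows "weakly_measurable G X"
  unfolding weakly_measurable_def
proof
  fix v :: 'a
  have "(\<lambda>x. inner x v) \<in> borel_measurable borel"
    by (intro borel_measurable_continuous_onI continuous_intros)
  from measurable_compose[OF assms this] show "(\<lambda>\<omega>. inner (X \<omega>) v) \<in> borel_measurable G" .
qed

text \<open>
Parseval's identity writes the scalar product as a countable sum of products of coordinates.
\<close>

lemma measurable_inner_weakly:
  fixes X Y :: "'w \<Rightarrow> 'a::real_inner" and e :: "nat \<Rightarrow> 'a"
  assumes "orthonormal_basis e" "weakly_measurable G X" "weakly_measurable G Y"
  shows "(\<lambda>\<omega>. inner (X \<omega>) (Y \<omega>)) \<in> borel_measurable G"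
proof -
  note [measurable] = assms(2,3)[THEN weakly_measurableD]
  have eq: "(\<lambda>\<omega>. inner (X \<omega>) (Y \<omega>)) = (\<lambda>\<omega>. \<Sum>j. inner (X \<omega>) (e j) * inner (Y \<omega>) (e j))"
    by (intro ext sums_unique parseval_inner assms(1))
  show ?thesis
    unfolding eq by measurable
qed

lemma measurable_norm_square_weakly:
  fixes X :: "'w \<Rightarrow> 'a::real_inner" and e :: "nat \<Rightarrow> 'a"
  assumes "orthonormal_basis e" "weakly_measurable G X"
  shows "(\<lambda>\<omega>. (norm (X \<omega>))\<^sup>2) \<in> borel_measurable G"
  using measurable_inner_weakly[OF assms(1) assms(2) assms(2)] by (simp add: power2_norm_eq_inner)


section \<open>Gaussian increments and independence\<close>

lemma real_gaussian_moments:
  assumes "0 \<le> v"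
  shows "integrable (real_gaussian v) (\<lambda>x. x)" "(\<integral>x. x \<partial>real_gaussian v) = 0"
    and "integrable (real_gaussian v) (\<lambda>x. x\<^sup>2)" "(\<integral>x. x\<^sup>2 \<partial>real_gaussian v) = v"
proof -
  have "integrable (real_gaussian v) (\<lambda>x. x) \<and> (\<integral>x. x \<partial>real_gaussian v) = 0 \<and>
      integrable (real_gaussian v) (\<lambda>x. x\<^sup>2) \<and> (\<integral>x. x\<^sup>2 \<partial>real_gaussian v) = v"
  proof (cases "v = 0")
    case True
    have eq: "real_gaussian v = return borel 0"
      using True by (simp add: real_gaussian_def)
    have I: "integrable (return borel (0 :: real)) f" "(\<integral>x. f x \<partial>return borel 0) = f 0"
      if f: "f \<in> borel_measurable borel" for f :: "real \<Rightarrow> real"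
    proof -
      show "integrable (return borel (0 :: real)) f"
        using f by (simp add: integrable_iff_bounded nn_integral_return)
      show "(\<integral>x. f x \<partial>return borel 0) = f 0"
        by (rule integral_return) (use f in simp_all)
    qed
    have sq: "(\<lambda>x :: real. x\<^sup>2) \<in> borel_measurable borel"
      by measurable
    show ?thesis
      unfolding eq using I(1)[OF measurable_ident] I(2)[OF measurable_ident] I(1)[OF sq] I(2)[OF sq] True
      by (simp add: id_def)
  next
    case False
    with assms have sd: "0 < sqrt v"
      by simp
    let ?n = "normal_density 0 (sqrt v)"
    have density: "real_gaussian v = density lborel ?n"
      using False by (simp add: real_gaussian_def)
    have transfer: "integrable (real_gaussian v) f \<longleftrightarrow> integrable lborel (\<lambda>x. ?n x * f x)"
      "(\<integral>x. f x \<partial>real_gaussian v) = (\<integral>x. ?n x * f x \<partial>lborel)"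
      if "f \<in> borel_measurable borel" for f :: "real \<Rightarrow> real"
      using that unfolding density by (simp_all add: integrable_density integral_density)
    have "(\<integral>x. ?n x * x\<^sup>2 \<partial>lborel) = v"
      using integral_normal_moment_even[OF sd, of 0 1] assms by simp
    moreover have "integrable lborel (\<lambda>x. ?n x * x\<^sup>2)"
      using integrable_normal_moment[OF sd, of 0 2] by simp
    moreover have "(\<lambda>x :: real. x) \<in> borel_measurable borel" "(\<lambda>x :: real. x\<^sup>2) \<in> borel_measurable borel"
      by measurable
    ultimately show ?thesis
      using integrable_normal_moment_nz_1[OF sd, of 0] integral_normal_moment_nz_1[OF sd, of 0]
      by (simp only: transfer)
  qed
  then show "integrable (real_gaussian v) (\<lambda>x. x)" "(\<integral>x. x \<partial>real_gaussian v) = 0"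
    "integrable (real_gaussian v) (\<lambda>x. x\<^sup>2)" "(\<integral>x. x\<^sup>2 \<partial>real_gaussian v) = v"
    by auto
qed

text \<open>
The law is given through its one-dimensional projections, so the moments are those of a normal
distribution of variance \<open>inner (R v) v\<close>, degenerate if this is zero.
\<close>

lemma centred_gaussian_projection_moments:
  fixes D :: "'w \<Rightarrow> 'a::real_inner"
  assumes D: "D \<in> borel_measurable M" and gauss: "centred_gaussian (distr M borel D) R"
    and "0 \<le> inner (R v) v"
  shows "integrable M (\<lambda>\<omega>. inner (D \<omega>) v)" "(\<integral>\<omega>. inner (D \<omega>) v \<partial>M) = 0"
    and "integrable M (\<lambda>\<omega>. (inner (D \<omega>) v)\<^sup>2)" "(\<integral>\<omega>. (inner (D \<omega>) v)\<^sup>2 \<partial>M) = inner (R v) v"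
proof -
  have [measurable]: "(\<lambda>x. inner x v) \<in> borel_measurable borel"
    by (intro borel_measurable_continuous_onI continuous_intros)
  note [measurable] = D weakly_measurableD[OF weakly_measurable_if_borel[OF D]]
  have "distr (distr M borel D) borel (\<lambda>x. inner x v) = real_gaussian (inner (R v) v)"
    using gauss by (simp add: centred_gaussian_def)
  then have law: "real_gaussian (inner (R v) v) = distr M borel (\<lambda>\<omega>. inner (D \<omega>) v)"
    by (simp add: distr_distr comp_def)
  note moments = real_gaussian_moments[OF assms(3), unfolded law]
  show "integrable M (\<lambda>\<omega>. inner (D \<omega>) v)" "(\<integral>\<omega>. inner (D \<omega>) v \<partial>M) = 0"
    using moments(1,2) by (simp_all add: integrable_distr_eq integral_distr)
  show "integrable M (\<lambda>\<omega>. (inner (D \<omega>) v)\<^sup>2)" "(\<integral>\<omega>. (inner (D \<omega>) v)\<^sup>2 \<partial>M) = inner (R v) v"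
    using moments(3,4) by (simp_all add: integrable_distr_eq integral_distr)
qed

text \<open>
Parseval's identity pointwise, then termwise integration of the nonnegative series of squared
coordinates, each of which has expectation \<open>inner (R (e j)) (e j)\<close>.
\<close>

lemma centred_gaussian_norm_square:
  fixes D :: "'w \<Rightarrow> 'a::real_inner" and e :: "nat \<Rightarrow> 'a"
  assumes e: "orthonormal_basis e" and D: "D \<in> borel_measurable M"
    and gauss: "centred_gaussian (distr M borel D) R"
    and nonneg: "\<And>v. 0 \<le> inner (R v) v" and trace: "summable (\<lambda>j. inner (R (e j)) (e j))"
  shows "integrable M (\<lambda>\<omega>. (norm (D \<omega>))\<^sup>2)"
    and "(\<integral>\<omega>. (norm (D \<omega>))\<^sup>2 \<partial>M) = (\<Sum>j. inner (R (e j)) (e j))"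
proof -
  note moments = centred_gaussian_projection_moments(3,4)[OF D gauss nonneg]
  have sums: "(\<lambda>j. (inner (D \<omega>) (e j))\<^sup>2) sums (norm (D \<omega>))\<^sup>2" for \<omega>
    using parseval_inner[OF e, of "D \<omega>" "D \<omega>"]
    by (simp only: power2_norm_eq_inner power2_eq_square[of "inner (D \<omega>) (e _)"])
  have eq: "(norm (D \<omega>))\<^sup>2 = (\<Sum>j. (inner (D \<omega>) (e j))\<^sup>2)" for \<omega>
    using sums_unique[OF sums] .
  have pointwise: "AE \<omega> in M. summable (\<lambda>j. norm ((inner (D \<omega>) (e j))\<^sup>2))"
    using sums by (simp add: sums_iff)
  have total: "summable (\<lambda>j. \<integral>\<omega>. norm ((inner (D \<omega>) (e j))\<^sup>2) \<partial>M)"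
    using trace by (simp add: moments(2))
  show "integrable M (\<lambda>\<omega>. (norm (D \<omega>))\<^sup>2)"
    unfolding eq by (rule integrable_suminf[OF moments(1) pointwise total])
  show "(\<integral>\<omega>. (norm (D \<omega>))\<^sup>2 \<partial>M) = (\<Sum>j. inner (R (e j)) (e j))"
    unfolding eq integral_suminf[OF moments(1) pointwise total] by (simp add: moments(2))
qed

lemma integrable_inner_of_square_integrable:
  fixes X Y :: "'w \<Rightarrow> 'a::real_inner" and e :: "nat \<Rightarrow> 'a"
  assumes e: "orthonormal_basis e" and wm: "weakly_measurable M X" "weakly_measurable M Y"
    and int: "integrable M (\<lambda>\<omega>. (norm (X \<omega>))\<^sup>2)" "integrable M (\<lambda>\<omega>. (norm (Y \<omega>))\<^sup>2)"
  shows "integrable M (\<lambda>\<omega>. inner (X \<omega>) (Y \<omega>))" "integrable M (\<lambda>\<omega>. norm (X \<omega>) * norm (Y \<omega>))"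
proof -
  have bound: "norm (X \<omega>) * norm (Y \<omega>) \<le> (norm (X \<omega>))\<^sup>2 + (norm (Y \<omega>))\<^sup>2" for \<omega>
  proof -
    have "0 \<le> norm (X \<omega>) * norm (Y \<omega>)"
      by simp
    then show ?thesis
      using sum_squares_bound[of "norm (X \<omega>)" "norm (Y \<omega>)"] by linarith
  qed
  have sum: "integrable M (\<lambda>\<omega>. (norm (X \<omega>))\<^sup>2 + (norm (Y \<omega>))\<^sup>2)"
    using int by simp
  note [measurable] = measurable_norm_square_weakly[OF e wm(1)] measurable_norm_square_weakly[OF e wm(2)]
  have "(\<lambda>\<omega>. sqrt ((norm (X \<omega>))\<^sup>2) * sqrt ((norm (Y \<omega>))\<^sup>2)) \<in> borel_measurable M"
    by measurable
  then show "integrable M (\<lambda>\<omega>. norm (X \<omega>) * norm (Y \<omega>))"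
    by (intro Bochner_Integration.integrable_bound[OF sum]) (auto intro!: bound)
  have "\<bar>inner (X \<omega>) (Y \<omega>)\<bar> \<le> (norm (X \<omega>))\<^sup>2 + (norm (Y \<omega>))\<^sup>2" for \<omega>
    by (rule order_trans[OF Cauchy_Schwarz_ineq2 bound])
  then show "integrable M (\<lambda>\<omega>. inner (X \<omega>) (Y \<omega>))"
    by (intro Bochner_Integration.integrable_bound[OF sum] measurable_inner_weakly[OF e wm]) auto
qed

text \<open>
The preimages under \<open>X\<close> lie in \<open>G\<close> and those under \<open>g \<circ> D\<close> in the \<open>\<sigma>\<close>-algebra generated by \<open>D\<close>, so
independence is inherited from these larger \<open>\<sigma>\<close>-algebras.
\<close>

lemma (in prob_space) indep_var_of_independent_increment:
  assumes sub: "subalgebra M G" and X: "X \<in> borel_measurable G" and D: "D \<in> borel_measurable M"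
    and indep: "indep_set (sets G) (sets (vimage_algebra (space M) D borel))"
    and g: "g \<in> borel_measurable borel"
  shows "indep_var borel X borel (\<lambda>\<omega>. g (D \<omega>))"
proof -
  have space: "space G = space M"
    using sub by (simp add: subalgebra_def)
  have X': "X \<in> borel_measurable M"
    using measurable_from_subalg[OF sub X] .
  have gD: "(\<lambda>\<omega>. g (D \<omega>)) \<in> borel_measurable M"
    using measurable_compose[OF D g] .
  have 1: "sigma_sets (space M) {X -` A \<inter> space M |A. A \<in> sets borel} \<subseteq> sets G"
    unfolding space[symmetric] by (rule sets.sigma_sets_subset) (use X in \<open>auto intro: measurable_sets\<close>)
  have "(\<lambda>\<omega>. g (D \<omega>)) -` A \<inter> space M \<in> sets (vimage_algebra (space M) D borel)" if "A \<in> sets borel" for A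
  proof -
    have "D -` (g -` A) \<inter> space M \<in> sets (vimage_algebra (space M) D borel)"
      by (rule in_vimage_algebra) (use measurable_sets[OF g that] in simp)
    then show ?thesis
      by (simp add: vimage_def)
  qed
  then have 2: "sigma_sets (space M) {(\<lambda>\<omega>. g (D \<omega>)) -` A \<inter> space M |A. A \<in> sets borel}
      \<subseteq> sets (vimage_algebra (space M) D borel)"
    using sets.sigma_sets_subset[of "{(\<lambda>\<omega>. g (D \<omega>)) -` A \<inter> space M |A. A \<in> sets borel}"
        "vimage_algebra (space M) D borel"] by auto
  have "indep_set A B" if "A \<subseteq> sets G" "B \<subseteq> sets (vimage_algebra (space M) D borel)" for A B
    using indep that unfolding indep_sets2_eq by blast
  from this[OF 1 2] X' gD show ?thesis
    unfolding indep_var_eq by (intro conjI)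
qed

text \<open>
Coordinate by coordinate the expectation factorises and vanishes. Dominated convergence with the
majorant \<open>\<parallel>Y\<parallel> \<parallel>D\<parallel>\<close> carries this from the partial sums of \<open>Y\<close> to \<open>Y\<close> itself.
\<close>

lemma (in prob_space) expectation_inner_independent:
  fixes Y D :: "'a \<Rightarrow> 'b::real_inner" and e :: "nat \<Rightarrow> 'b"
  assumes e: "orthonormal_basis e" and sub: "subalgebra M G"
    and Y: "weakly_measurable G Y" and D: "D \<in> borel_measurable M"
    and indep: "indep_set (sets G) (sets (vimage_algebra (space M) D borel))"
    and int: "integrable M (\<lambda>\<omega>. (norm (Y \<omega>))\<^sup>2)" "integrable M (\<lambda>\<omega>. (norm (D \<omega>))\<^sup>2)"
    and mean: "\<And>v. integrable M (\<lambda>\<omega>. inner (D \<omega>) v)" "\<And>v. (\<integral>\<omega>. inner (D \<omega>) v \<partial>M) = 0"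
  shows "(\<integral>\<omega>. inner (Y \<omega>) (D \<omega>) \<partial>M) = 0"
proof -
  have wY: "weakly_measurable M Y"
    using Y measurable_from_subalg[OF sub] by (auto simp: weakly_measurable_def)
  have wD: "weakly_measurable M D"
    using D by (rule weakly_measurable_if_borel)
  note [measurable] = wY[THEN weakly_measurableD] wD[THEN weakly_measurableD]
  have intY: "integrable M (\<lambda>\<omega>. inner (Y \<omega>) v)" for v
  proof (rule integrable_inner_of_square_integrable(1)[OF e wY _ int(1)])
    show "weakly_measurable M (\<lambda>_. v)"
      by (simp add: weakly_measurable_def)
  qed simp
  have zero: "integrable M (\<lambda>\<omega>. inner (Y \<omega>) (e j) * inner (D \<omega>) (e j))"
    "(\<integral>\<omega>. inner (Y \<omega>) (e j) * inner (D \<omega>) (e j) \<partial>M) = 0" for j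
  proof -
    have "(\<lambda>x. inner x (e j)) \<in> borel_measurable borel"
      by (intro borel_measurable_continuous_onI continuous_intros)
    then have "indep_var borel (\<lambda>\<omega>. inner (Y \<omega>) (e j)) borel (\<lambda>\<omega>. inner (D \<omega>) (e j))"
      by (rule indep_var_of_independent_increment[OF sub weakly_measurableD[OF Y] D indep])
    from indep_var_integrable[OF this intY mean(1)] indep_var_lebesgue_integral[OF this intY mean(1)]
    show "integrable M (\<lambda>\<omega>. inner (Y \<omega>) (e j) * inner (D \<omega>) (e j))"
      "(\<integral>\<omega>. inner (Y \<omega>) (e j) * inner (D \<omega>) (e j) \<partial>M) = 0"
      by (simp_all add: mean(2))
  qed
  have "(\<lambda>n. \<integral>\<omega>. inner (fourier_partial_sum e n (Y \<omega>)) (D \<omega>) \<partial>M) \<longlonglongrightarrow> (\<integral>\<omega>. inner (Y \<omega>) (D \<omega>) \<partial>M)"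
  proof (rule integral_dominated_convergence[where w = "\<lambda>\<omega>. norm (Y \<omega>) * norm (D \<omega>)"])
    show "(\<lambda>\<omega>. inner (Y \<omega>) (D \<omega>)) \<in> borel_measurable M"
      by (rule measurable_inner_weakly[OF e wY wD])
    show "(\<lambda>\<omega>. inner (fourier_partial_sum e n (Y \<omega>)) (D \<omega>)) \<in> borel_measurable M" for n
      unfolding inner_fourier_partial_sum by measurable
    show "integrable M (\<lambda>\<omega>. norm (Y \<omega>) * norm (D \<omega>))"
      by (rule integrable_inner_of_square_integrable(2)[OF e wY wD int])
    show "AE \<omega> in M. (\<lambda>n. inner (fourier_partial_sum e n (Y \<omega>)) (D \<omega>)) \<longlonglongrightarrow> inner (Y \<omega>) (D \<omega>)"
      by (intro AE_I2 tendsto_inner fourier_partial_sum_tendsto[OF e] tendsto_const)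
    fix n
    have "norm (inner (fourier_partial_sum e n y) d) \<le> norm y * norm d" for y d
      using order_trans[OF Cauchy_Schwarz_ineq2 mult_right_mono[OF norm_fourier_partial_sum_le[OF e] norm_ge_zero]]
      by simp
    then show "AE \<omega> in M. norm (inner (fourier_partial_sum e n (Y \<omega>)) (D \<omega>)) \<le> norm (Y \<omega>) * norm (D \<omega>)"
      by simp
  qed
  moreover have "(\<integral>\<omega>. inner (fourier_partial_sum e n (Y \<omega>)) (D \<omega>) \<partial>M) = 0" for n
    unfolding inner_fourier_partial_sum by (simp add: zero)
  ultimately show ?thesis
    by (simp add: LIMSEQ_const_iff)
qed


section \<open>Unitary operators and multiplication by the potential\<close>

lemma mass_eq_norm_square: "mass u = (norm u)\<^sup>2"
  unfolding power2_norm_eq_inner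
proof transfer
  fix f :: "real ^ 'a \<Rightarrow> complex"
  have "(\<integral>x. f x * cnj (f x) \<partial>torus) = (\<integral>x. complex_of_real ((norm (f x))\<^sup>2) \<partial>torus)"
    by (simp only: complex_norm_square)
  then show "(\<integral>x. (norm (f x))\<^sup>2 \<partial>torus) = Re (\<integral>x. f x * cnj (f x) \<partial>torus)"
    by (simp only: integral_complex_of_real Re_complex_of_real)
qed

lemma inner_scaleC_left: "inner (c *\<^sub>C u) v = inner u (cnj c *\<^sub>C v)"
  by transfer (simp add: mult_ac)

lemma scaleC_scaleC: "a *\<^sub>C b *\<^sub>C u = (a * b) *\<^sub>C u"
  by transfer (auto simp: ae_equal_def square_integrable_scale mult.assoc)

lemma scaleC_minus_left: "(- c) *\<^sub>C u = - (c *\<^sub>C u)"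
  by transfer (auto simp: ae_equal_def square_integrable_uminus square_integrable_scale)

lemma scaleC_of_real: "of_real r *\<^sub>C u = r *\<^sub>R u"
  by transfer (auto simp: ae_equal_def square_integrable_scaleR square_integrable_scale scaleR_conv_of_real)

lemma norm_scaleC: "norm (c *\<^sub>C u) = norm c * norm u"
proof -
  have "inner (c *\<^sub>C u) (c *\<^sub>C u) = inner u ((cnj c * c) *\<^sub>C u)"
    by (simp add: inner_scaleC_left scaleC_scaleC)
  also have "cnj c * c = of_real ((norm c)\<^sup>2)"
    by (metis complex_norm_square mult.commute)
  finally have "(norm (c *\<^sub>C u))\<^sup>2 = (norm c * norm u)\<^sup>2"
    by (simp add: scaleC_of_real power2_norm_eq_inner power_mult_distrib)
  then show ?thesis
    by (simp add: power2_eq_iff_nonneg)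
qed

lemma unitary_operator_diff:
  assumes "unitary_operator U"
  shows "U (u - v) = U u - U v"
proof -
  have "U (u - v) + U v = U u"
    using assms unfolding unitary_operator_def by (metis diff_add_cancel)
  then show ?thesis
    by (simp add: eq_diff_eq)
qed

lemma unitary_operator_inner:
  assumes "unitary_operator U"
  shows "inner (U u) (U v) = inner u v"
proof -
  have "inner x y = ((norm (x + y))\<^sup>2 - (norm x)\<^sup>2 - (norm y)\<^sup>2) / 2" for x y :: "'a L2"
    by (simp add: power2_norm_eq_inner inner_add_left inner_add_right inner_commute)
  then show ?thesis
    using assms unfolding unitary_operator_def by metis
qed

text \<open>
Since \<open>U\<close> is onto, every \<open>v\<close> is some \<open>U v'\<close>, and then \<open>(U x, v) = (x, v')\<close>.
\<close>

lemma weakly_measurable_unitary: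
  assumes "unitary_operator U" "weakly_measurable G X"
  shows "weakly_measurable G (\<lambda>\<omega>. U (X \<omega>))"
  unfolding weakly_measurable_def
proof
  fix v
  obtain v' where "v = U v'"
    using assms(1) unfolding unitary_operator_def by (metis surjD)
  then show "(\<lambda>\<omega>. inner (U (X \<omega>)) v) \<in> borel_measurable G"
    using weakly_measurableD[OF assms(2), of v'] by (simp add: unitary_operator_inner[OF assms(1)])
qed

lemma weakly_measurable_scaleC:
  assumes "weakly_measurable G X"
  shows "weakly_measurable G (\<lambda>\<omega>. c *\<^sub>C X \<omega>)"
  using assms by (simp add: weakly_measurable_def inner_scaleC_left)

lemma weakly_measurable_diff:
  assumes "weakly_measurable G X" "weakly_measurable G Y"
  shows "weakly_measurable G (\<lambda>\<omega>. X \<omega> - Y \<omega>)"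
  unfolding weakly_measurable_def inner_diff_left
  by (intro allI borel_measurable_diff weakly_measurableD assms)

lemma square_integrable_bounded_mult:
  assumes f: "square_integrable f" "AE x in torus. norm (f x) \<le> B" and g: "square_integrable g"
  shows "square_integrable (\<lambda>x. f x * g x)"
    and "(\<integral>x. (norm (f x * g x))\<^sup>2 \<partial>torus) \<le> B\<^sup>2 * (\<integral>x. (norm (g x))\<^sup>2 \<partial>torus)"
proof -
  note [measurable] = square_integrable_measurable[OF f(1)] square_integrable_measurable[OF g]
  have g2: "integrable torus (\<lambda>x. B\<^sup>2 * (norm (g x))\<^sup>2)"
    using g by (simp add: square_integrable_def)
  have le: "AE x in torus. (norm (f x * g x))\<^sup>2 \<le> B\<^sup>2 * (norm (g x))\<^sup>2"
    using f(2)
  proof eventually_elim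
    case (elim x)
    then show ?case
      unfolding norm_mult power_mult_distrib by (intro mult_right_mono power_mono) auto
  qed
  have fg: "integrable torus (\<lambda>x. (norm (f x * g x))\<^sup>2)"
    by (rule Bochner_Integration.integrable_bound[OF g2]) (use le in auto)
  then show "square_integrable (\<lambda>x. f x * g x)"
    by (simp add: square_integrable_def)
  have "(\<integral>x. (norm (f x * g x))\<^sup>2 \<partial>torus) \<le> (\<integral>x. B\<^sup>2 * (norm (g x))\<^sup>2 \<partial>torus)"
    using fg g2 le by (rule integral_mono_AE)
  then show "(\<integral>x. (norm (f x * g x))\<^sup>2 \<partial>torus) \<le> B\<^sup>2 * (\<integral>x. (norm (g x))\<^sup>2 \<partial>torus)"
    by simp
qed

text \<open>
With \<open>V\<close> essentially bounded the default value of \<open>mult_L2\<close> is never taken, so the product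
is the pointwise one.
\<close>

lemma norm_mult_L2_le:
  assumes "essentially_bounded B V" "0 \<le> B"
  shows "norm (mult_L2 V u) \<le> B * norm u"
proof -
  have "mass (mult_L2 V u) \<le> B\<^sup>2 * mass u"
    using assms(1)
  proof transfer
    fix B and f g :: "real ^ 'a \<Rightarrow> complex"
    assume "ae_equal f f" "ae_equal g g" "AE x in torus. norm (f x) \<le> B"
    then have "square_integrable (\<lambda>x. f x * g x)"
      "(\<integral>x. (norm (f x * g x))\<^sup>2 \<partial>torus) \<le> B\<^sup>2 * (\<integral>x. (norm (g x))\<^sup>2 \<partial>torus)"
      using square_integrable_bounded_mult[of f B g] by (simp_all add: ae_equal_def)
    then show "(\<integral>x. (norm ((if square_integrable (\<lambda>x. f x * g x) then \<lambda>x. f x * g x else (\<lambda>x. 0)) x))\<^sup>2 \<partial>torus)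
        \<le> B\<^sup>2 * (\<integral>x. (norm (g x))\<^sup>2 \<partial>torus)"
      by simp
  qed
  then have "(norm (mult_L2 V u))\<^sup>2 \<le> (B * norm u)\<^sup>2"
    by (simp add: mass_eq_norm_square power_mult_distrib)
  then show ?thesis
    using assms(2) by (simp add: power2_le_iff_abs_le)
qed

lemma inner_mult_L2_real:
  assumes "essentially_bounded B V" "real_valued V"
  shows "inner (mult_L2 V u) v = inner u (mult_L2 V v)"
  using assms
proof transfer
  fix B and f g h :: "real ^ 'a \<Rightarrow> complex"
  assume f: "ae_equal f f" and g: "ae_equal g g" and h: "ae_equal h h"
    and bdd: "AE x in torus. norm (f x) \<le> B" and real: "AE x in torus. f x \<in> \<real>"
  have [simp]: "square_integrable (\<lambda>x. f x * g x)" "square_integrable (\<lambda>x. f x * h x)"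
    using square_integrable_bounded_mult(1)[of f B] f g h bdd by (simp_all add: ae_equal_def)
  have [measurable]: "f \<in> borel_measurable torus" "g \<in> borel_measurable torus" "h \<in> borel_measurable torus"
    using f g h by (simp_all add: ae_equal_def square_integrable_def)
  have "(\<integral>x. f x * g x * cnj (h x) \<partial>torus) = (\<integral>x. g x * cnj (f x * h x) \<partial>torus)"
  proof (rule integral_cong_AE)
    show "AE x in torus. f x * g x * cnj (h x) = g x * cnj (f x * h x)"
      using real by eventually_elim (simp add: Reals_cnj_iff)
  qed measurable
  then show "Re (\<integral>x. (if square_integrable (\<lambda>x. f x * g x) then \<lambda>x. f x * g x else (\<lambda>x. 0)) x * cnj (h x) \<partial>torus)
      = Re (\<integral>x. g x * cnj ((if square_integrable (\<lambda>x. f x * h x) then \<lambda>x. f x * h x else (\<lambda>x. 0)) x) \<partial>torus)"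
    by simp
qed

lemma mult_L2_scaleC:
  assumes "essentially_bounded B V"
  shows "mult_L2 V (c *\<^sub>C u) = c *\<^sub>C mult_L2 V u"
  using assms
proof transfer
  fix B c and f g :: "real ^ 'a \<Rightarrow> complex"
  assume f: "ae_equal f f" and g: "ae_equal g g" and bdd: "AE x in torus. norm (f x) \<le> B"
  have [simp]: "square_integrable (\<lambda>x. f x * g x)"
    using square_integrable_bounded_mult(1)[of f B] f g bdd by (simp_all add: ae_equal_def)
  have [simp]: "square_integrable (\<lambda>x. f x * (c * g x))"
    using square_integrable_scale[of "\<lambda>x. f x * g x" c] by (simp add: mult_ac)
  show "ae_equal (if square_integrable (\<lambda>x. f x * (c * g x)) then \<lambda>x. f x * (c * g x) else (\<lambda>x. 0))
      (\<lambda>x. c * (if square_integrable (\<lambda>x. f x * g x) then \<lambda>x. f x * g x else (\<lambda>x. 0)) x)"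
    by (simp add: ae_equal_def square_integrable_scale mult.left_commute)
qed

text \<open>
Multiplication by \<open>V\<close> is symmetric and commutes with \<open>\<i>\<close>, whereas \<open>\<i>\<close> is antisymmetric for the real
scalar product; hence \<open>(u, \<i> V u)\<close> equals its own negative.
\<close>

lemma inner_i_potential_eq_zero:
  assumes "essentially_bounded B V" "real_valued V"
  shows "inner u (\<i> *\<^sub>C mult_L2 V u) = 0"
proof -
  have "inner u (\<i> *\<^sub>C mult_L2 V u) = inner (mult_L2 V u) (\<i> *\<^sub>C u)"
    by (simp add: mult_L2_scaleC[OF assms(1), symmetric] inner_mult_L2_real[OF assms])
  also have "\<dots> = - inner (\<i> *\<^sub>C mult_L2 V u) u"
    by (simp add: inner_scaleC_left scaleC_minus_left)
  finally show ?thesis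
    by (simp add: inner_commute)
qed

lemma norm_potential_step:
  assumes "essentially_bounded B V" "real_valued V"
  shows "(norm (u - (\<i> * of_real k) *\<^sub>C mult_L2 V u))\<^sup>2 = (norm u)\<^sup>2 + k\<^sup>2 * (norm (mult_L2 V u))\<^sup>2"
proof -
  have "(\<i> * of_real k) *\<^sub>C mult_L2 V u = k *\<^sub>R (\<i> *\<^sub>C mult_L2 V u)"
    by (metis mult.commute scaleC_of_real scaleC_scaleC)
  moreover have "(norm (u - k *\<^sub>R w))\<^sup>2 = (norm u)\<^sup>2 + k\<^sup>2 * (norm w)\<^sup>2" if "inner u w = 0" for w
    using that unfolding power2_norm_eq_inner
    by (simp add: inner_diff_left inner_diff_right inner_commute[of w u] power2_eq_square)
  moreover have "norm (\<i> *\<^sub>C mult_L2 V u) = norm (mult_L2 V u)"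
    by (simp add: norm_scaleC)
  ultimately show ?thesis
    using inner_i_potential_eq_zero[OF assms] by simp
qed

lemma weakly_measurable_mult_L2:
  assumes "essentially_bounded B V" "real_valued V" "weakly_measurable G X"
  shows "weakly_measurable G (\<lambda>\<omega>. mult_L2 V (X \<omega>))"
  using assms(3) by (simp add: weakly_measurable_def inner_mult_L2_real[OF assms(1,2)])


section \<open>The evolution of the expected mass\<close>

text \<open>
All three terms of the scheme carry the factor \<open>S(k)\<close>, which therefore drops out of the norm.
\<close>

lemma exponential_integrator_Suc_unitary:
  assumes "unitary_operator (S k)"
  shows "exponential_integrator S V W u\<^sub>0 k (Suc n) \<omega>
    = S k ((exponential_integrator S V W u\<^sub>0 k n \<omega>
        - (\<i> * of_real k) *\<^sub>C mult_L2 V (exponential_integrator S V W u\<^sub>0 k n \<omega>))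
      - \<i> *\<^sub>C (W (real (Suc n) * k) \<omega> - W (real n * k) \<omega>))"
  using assms by (simp add: unitary_operator_diff[OF assms] unitary_operator_def)

lemma weakly_measurable_mono:
  assumes "weakly_measurable G X" "space G = space H" "sets G \<subseteq> sets H"
  shows "weakly_measurable H X"
  using assms(1) measurable_mono[OF order_refl refl assms(3) assms(2)]
  by (auto simp: weakly_measurable_def)

text \<open>
One step of the scheme before the application of \<open>S(k)\<close>, from the state \<open>u\<close> with increment \<open>D\<close> of
covariance \<open>R\<close>. The state enters the mixed term only through \<open>Y = - \<i> (u - \<i> k V u)\<close>, which is
measurable with respect to the past \<open>G\<close>.
\<close>

lemma (in prob_space) integrator_step:
  fixes u D w :: "'a \<Rightarrow> 'd::finite L2" and k :: real and R :: "'d L2 \<Rightarrow> 'd L2" and e :: "nat \<Rightarrow> 'd L2"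
  assumes e: "orthonormal_basis e" and sub: "subalgebra M G"
    and u: "weakly_measurable G u" "integrable M (\<lambda>\<omega>. (norm (u \<omega>))\<^sup>2)"
    and D: "D \<in> borel_measurable M"
    and indep: "indep_set (sets G) (sets (vimage_algebra (space M) D borel))"
    and gauss: "centred_gaussian (distr M borel D) R"
    and nonneg: "\<And>v. 0 \<le> inner (R v) v" and trace: "summable (\<lambda>j. inner (R (e j)) (e j))"
    and V: "essentially_bounded B V" "0 \<le> B" "real_valued V"
    and w: "\<And>\<omega>. w \<omega> = u \<omega> - (\<i> * of_real k) *\<^sub>C mult_L2 V (u \<omega>) - \<i> *\<^sub>C D \<omega>"
  shows "integrable M (\<lambda>\<omega>. (norm (w \<omega>))\<^sup>2)"
    and "expectation (\<lambda>\<omega>. (norm (mult_L2 V (u \<omega>)))\<^sup>2) \<le> B\<^sup>2 * expectation (\<lambda>\<omega>. (norm (u \<omega>))\<^sup>2)"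
    and "expectation (\<lambda>\<omega>. (norm (w \<omega>))\<^sup>2) = expectation (\<lambda>\<omega>. (norm (u \<omega>))\<^sup>2)
      + k\<^sup>2 * expectation (\<lambda>\<omega>. (norm (mult_L2 V (u \<omega>)))\<^sup>2) + (\<Sum>j. inner (R (e j)) (e j))"
proof -
  define X where "X \<omega> = u \<omega> - (\<i> * of_real k) *\<^sub>C mult_L2 V (u \<omega>)" for \<omega>
  define Y where "Y \<omega> = cnj \<i> *\<^sub>C X \<omega>" for \<omega>
  have Vu: "weakly_measurable G (\<lambda>\<omega>. mult_L2 V (u \<omega>))"
    by (rule weakly_measurable_mult_L2[OF V(1,3) u(1)])
  have bound: "(norm (mult_L2 V (u \<omega>)))\<^sup>2 \<le> B\<^sup>2 * (norm (u \<omega>))\<^sup>2" for \<omega>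
    using power_mono[OF norm_mult_L2_le[OF V(1,2), of "u \<omega>"] norm_ge_zero, of 2]
    by (simp add: power_mult_distrib)
  have int_Vu: "integrable M (\<lambda>\<omega>. (norm (mult_L2 V (u \<omega>)))\<^sup>2)"
  proof (rule Bochner_Integration.integrable_bound)
    show "integrable M (\<lambda>\<omega>. B\<^sup>2 * (norm (u \<omega>))\<^sup>2)"
      using u(2) by simp
    show "(\<lambda>\<omega>. (norm (mult_L2 V (u \<omega>)))\<^sup>2) \<in> borel_measurable M"
      by (rule measurable_from_subalg[OF sub measurable_norm_square_weakly[OF e Vu]])
  qed (use bound in simp)
  show "expectation (\<lambda>\<omega>. (norm (mult_L2 V (u \<omega>)))\<^sup>2) \<le> B\<^sup>2 * expectation (\<lambda>\<omega>. (norm (u \<omega>))\<^sup>2)"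
    using integral_mono[OF int_Vu integrable_mult_right[OF u(2)] bound] by simp
  have norm_X: "(norm (X \<omega>))\<^sup>2 = (norm (u \<omega>))\<^sup>2 + k\<^sup>2 * (norm (mult_L2 V (u \<omega>)))\<^sup>2" for \<omega>
    unfolding X_def by (rule norm_potential_step[OF V(1,3)])
  have Y: "weakly_measurable G Y"
    unfolding Y_def X_def by (intro weakly_measurable_scaleC weakly_measurable_diff u(1) Vu)
  then have YM: "weakly_measurable M Y"
    using measurable_from_subalg[OF sub] by (auto simp: weakly_measurable_def)
  have int_Y: "integrable M (\<lambda>\<omega>. (norm (Y \<omega>))\<^sup>2)"
    using u(2) int_Vu by (simp add: Y_def norm_scaleC norm_X)
  note D2 = centred_gaussian_norm_square[OF e D gauss nonneg trace]
  have cross: "integrable M (\<lambda>\<omega>. inner (Y \<omega>) (D \<omega>))" "expectation (\<lambda>\<omega>. inner (Y \<omega>) (D \<omega>)) = 0"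
    using integrable_inner_of_square_integrable(1)[OF e YM weakly_measurable_if_borel[OF D] int_Y D2(1)]
      expectation_inner_independent[OF e sub Y D indep int_Y D2(1)
        centred_gaussian_projection_moments(1,2)[OF D gauss nonneg]]
    by auto
  have norm_w: "(norm (w \<omega>))\<^sup>2 = (norm (u \<omega>))\<^sup>2 + k\<^sup>2 * (norm (mult_L2 V (u \<omega>)))\<^sup>2
      + (norm (D \<omega>))\<^sup>2 - 2 * inner (Y \<omega>) (D \<omega>)" for \<omega>
  proof -
    have "(norm (x - y))\<^sup>2 = (norm x)\<^sup>2 + (norm y)\<^sup>2 - 2 * inner x y" for x y :: "'d L2"
      unfolding power2_norm_eq_inner by (simp add: inner_diff_left inner_diff_right inner_commute[of y x])
    from this[of "X \<omega>" "\<i> *\<^sub>C D \<omega>"] show ?thesis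
      by (simp add: w X_def[symmetric] norm_X norm_scaleC Y_def inner_scaleC_left)
  qed
  show "integrable M (\<lambda>\<omega>. (norm (w \<omega>))\<^sup>2)"
    unfolding norm_w using u(2) int_Vu D2(1) cross(1) by simp
  show "expectation (\<lambda>\<omega>. (norm (w \<omega>))\<^sup>2) = expectation (\<lambda>\<omega>. (norm (u \<omega>))\<^sup>2)
      + k\<^sup>2 * expectation (\<lambda>\<omega>. (norm (mult_L2 V (u \<omega>)))\<^sup>2) + (\<Sum>j. inner (R (e j)) (e j))"
    unfolding norm_w using u(2) int_Vu D2 cross by simp
qed

text \<open>
The deviation of \<open>a n\<close> from linear growth is \<open>k\<^sup>2 \<Sum>\<^sub>j\<^sub><\<^sub>n b j\<close>. Gronwall's inequality bounds \<open>a\<close>, hence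
\<open>b\<close>, uniformly up to time \<open>T\<close>, and the sum has \<open>n \<le> T/k\<close> terms, which leaves one power of \<open>k\<close>.
\<close>

lemma perturbed_recursion_linear_growth:
  fixes a b :: "nat \<Rightarrow> real"
  assumes step: "\<And>n. a (Suc n) = a n + k\<^sup>2 * b n + k * \<tau>"
    and b: "\<And>n. 0 \<le> b n" "\<And>n. b n \<le> \<beta> * a n"
    and nonneg: "0 \<le> a 0" "0 \<le> \<tau>" "0 \<le> \<beta>" "0 \<le> k" and "k \<le> T" "real n * k \<le> T"
  shows "\<bar>a n - a 0 - real n * k * \<tau>\<bar> \<le> T * (\<beta> * (exp (T\<^sup>2 * \<beta>) * (a 0 + T * \<tau>))) * k"
proof -
  define K where "K = exp (T\<^sup>2 * \<beta>) * (a 0 + T * \<tau>)"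
  have "0 \<le> T"
    using assms by linarith
  have growth: "a m \<le> (1 + k\<^sup>2 * \<beta>) ^ m * (a 0 + real m * k * \<tau>)" for m
  proof (induction m)
    case (Suc m)
    \<comment> \<open>The new inhomogeneity \<open>k \<tau>\<close> is enlarged by the full growth factor, so that it merges with
      the accumulated ones.\<close>
    have ge1: "1 \<le> (1 + k\<^sup>2 * \<beta>) ^ Suc m"
      using nonneg by (intro one_le_power) simp
    have "a (Suc m) \<le> (1 + k\<^sup>2 * \<beta>) * a m + k * \<tau>"
      using mult_left_mono[OF b(2)[of m], of "k\<^sup>2"] by (simp add: step algebra_simps)
    also have "\<dots> \<le> (1 + k\<^sup>2 * \<beta>) * ((1 + k\<^sup>2 * \<beta>) ^ m * (a 0 + real m * k * \<tau>))
        + (1 + k\<^sup>2 * \<beta>) ^ Suc m * (k * \<tau>)"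
      using nonneg mult_right_mono[OF ge1, of "k * \<tau>"] by (intro add_mono mult_left_mono Suc.IH) auto
    also have "\<dots> = (1 + k\<^sup>2 * \<beta>) ^ Suc m * (a 0 + real (Suc m) * k * \<tau>)"
      by (simp add: algebra_simps)
    finally show ?case .
  qed simp
  have bounded: "a m \<le> K" if "m \<le> n" for m
  proof -
    have mk: "real m * k \<le> T"
      using that nonneg assms(9) by (meson mult_right_mono of_nat_le_iff order_trans)
    have "(1 + k\<^sup>2 * \<beta>) ^ m \<le> exp (k\<^sup>2 * \<beta>) ^ m"
      using nonneg by (intro power_mono exp_ge_add_one_self) simp
    also have "\<dots> = exp (real m * k * (k * \<beta>))"
      by (simp add: exp_of_nat_mult[symmetric] power2_eq_square mult_ac)
    also have "\<dots> \<le> exp (T * (T * \<beta>))"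
      using nonneg mk \<open>k \<le> T\<close> \<open>0 \<le> T\<close> by (simp add: mult_mono mult_right_mono)
    finally have "(1 + k\<^sup>2 * \<beta>) ^ m \<le> exp (T\<^sup>2 * \<beta>)"
      by (simp add: power2_eq_square mult_ac)
    moreover have "a 0 + real m * k * \<tau> \<le> a 0 + T * \<tau>"
      using mk nonneg by (simp add: mult_right_mono)
    ultimately have "(1 + k\<^sup>2 * \<beta>) ^ m * (a 0 + real m * k * \<tau>) \<le> K"
      unfolding K_def using nonneg by (intro mult_mono) auto
    then show ?thesis
      using growth[of m] by linarith
  qed
  have K: "0 \<le> K"
    using nonneg \<open>0 \<le> T\<close> by (simp add: K_def)
  have telescope: "a m - a 0 - real m * k * \<tau> = k\<^sup>2 * (\<Sum>j<m. b j)" for m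
    by (induction m) (simp_all add: step algebra_simps)
  have "(\<Sum>j<n. b j) \<le> (\<Sum>j<n. \<beta> * K)"
  proof (rule sum_mono)
    fix j
    assume "j \<in> {..<n}"
    then have "\<beta> * a j \<le> \<beta> * K"
      using nonneg by (intro mult_left_mono bounded) auto
    then show "b j \<le> \<beta> * K"
      using b(2)[of j] by linarith
  qed
  then have "k\<^sup>2 * (\<Sum>j<n. b j) \<le> (real n * k) * (\<beta> * K) * k"
    using mult_left_mono[of "\<Sum>j<n. b j" "real n * (\<beta> * K)" "k\<^sup>2"] by (simp add: power2_eq_square mult_ac)
  also have "\<dots> \<le> T * (\<beta> * K) * k"
    using nonneg K assms(9) by (intro mult_right_mono) auto
  finally have "k\<^sup>2 * (\<Sum>j<n. b j) \<le> T * (\<beta> * K) * k" .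
  moreover have "0 \<le> k\<^sup>2 * (\<Sum>j<n. b j)"
    using b(1) by (simp add: sum_nonneg)
  ultimately show ?thesis
    unfolding telescope K_def by simp
qed

theorem proposition4p6:
  fixes T :: real
    and M :: "'w measure"
    and F :: "real \<Rightarrow> 'w measure"
    and S :: "real \<Rightarrow> 'd::finite L2 \<Rightarrow> 'd L2"
    and V :: "'d L2"
    and Q Qhalf :: "'d L2 \<Rightarrow> 'd L2"
    and e :: "nat \<Rightarrow> 'd L2"
    and W :: "real \<Rightarrow> 'w \<Rightarrow> 'd L2"
    and u\<^sub>0 :: "'w \<Rightarrow> 'd L2"
  assumes "CARD('d) \<in> {1, 2, 3}"
    and "0 < T"
    and "schroedinger_group S"
    and "prob_space M"
    and "normal_filtration M F"
    and "nonneg_selfadjoint Q"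
    and "square_root_of Q Qhalf"
    and "orthonormal_basis e"
    and "summable (\<lambda>j. (norm (Qhalf (e j)))\<^sup>2)"
    and "Q_Wiener_process_wrt M F Q W"
    and "\<And>t. 0 \<le> t \<Longrightarrow> integrable M (\<lambda>\<omega>. (norm (W t \<omega>))\<^sup>2)"
    and "u\<^sub>0 \<in> borel_measurable (F 0)"
    and "integrable M (\<lambda>\<omega>. mass (u\<^sub>0 \<omega>))"
    and "real_valued V"
    and "V \<in> H2"
  shows "\<exists>C. \<forall>N\<ge>1. \<forall>n. real n * (T / real N) \<le> T \<longrightarrow>
    integrable M (\<lambda>\<omega>. mass (exponential_integrator S V W u\<^sub>0 (T / real N) n \<omega>)) \<and>
    \<bar>(\<integral>\<omega>. mass (exponential_integrator S V W u\<^sub>0 (T / real N) n \<omega>) \<partial>M)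
      - (\<integral>\<omega>. mass (u\<^sub>0 \<omega>) \<partial>M)
      - real n * (T / real N) * (\<Sum>j. (norm (Qhalf (e j)))\<^sup>2)\<bar> \<le> C * (T / real N)"
proof -
  interpret prob_space M
    by fact
  obtain B where B: "0 \<le> B" "essentially_bounded B V"
    using H2_essentially_bounded[OF assms(1,15)] by blast
  define \<tau> where "\<tau> = (\<Sum>j. (norm (Qhalf (e j)))\<^sup>2)"
  have \<tau>: "0 \<le> \<tau>"
    unfolding \<tau>_def by (rule suminf_nonneg[OF assms(9)]) simp
  have unitary: "unitary_operator (S t)" for t
    using assms(3) by (simp add: schroedinger_group_def unitary_group_def)
  have norm_S: "norm (S t v) = norm v" for t v
    using unitary[of t] by (simp add: unitary_operator_def)
  have Q: "inner (Q v) v = (norm (Qhalf v))\<^sup>2" for v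
    using assms(7) by (auto simp: square_root_of_def nonneg_selfadjoint_def power2_norm_eq_inner)
  note W = assms(10)[unfolded Q_Wiener_process_wrt_def Q_Wiener_process_def]
  have increment_measurable: "(\<lambda>\<omega>. W t \<omega> - W s \<omega>) \<in> borel_measurable M" if "0 \<le> s" "s \<le> t" for s t
  proof -
    \<comment> \<open>In a space not known to be second countable a difference need not inherit Borel measurability;
      it is part of the independence of increments, here used for the partition with points \<open>s, t\<close>.\<close>
    define p where "p i = (if i = 0 then s else t)" for i :: nat
    have "0 \<le> p 0" "\<forall>i<1. p i \<le> p (Suc i)"
      using that by (simp_all add: p_def)
    then have "indep_vars (\<lambda>_. borel) (\<lambda>i \<omega>. W (p (Suc i)) \<omega> - W (p i) \<omega>) {..<1}"
      using W by blast
    then show ?thesis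
      by (auto simp: indep_vars_def p_def)
  qed
  have main: "integrable M (\<lambda>\<omega>. mass (exponential_integrator S V W u\<^sub>0 k n \<omega>)) \<and>
      \<bar>(\<integral>\<omega>. mass (exponential_integrator S V W u\<^sub>0 k n \<omega>) \<partial>M) - (\<integral>\<omega>. mass (u\<^sub>0 \<omega>) \<partial>M) - real n * k * \<tau>\<bar>
        \<le> T * (B\<^sup>2 * (exp (T\<^sup>2 * B\<^sup>2) * ((\<integral>\<omega>. mass (u\<^sub>0 \<omega>) \<partial>M) + T * \<tau>))) * k"
    if k: "0 \<le> k" "k \<le> T" and n: "real n * k \<le> T" for k n
  proof -
    define U where "U m = exponential_integrator S V W u\<^sub>0 k m" for m
    define D where "D m \<omega> = W (real (Suc m) * k) \<omega> - W (real m * k) \<omega>" for m \<omega>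
    define w where "w m \<omega> = U m \<omega> - (\<i> * of_real k) *\<^sub>C mult_L2 V (U m \<omega>) - \<i> *\<^sub>C D m \<omega>" for m \<omega>
    define R where "R v = k *\<^sub>R Q v" for v
    have times: "0 \<le> real m * k" "real m * k \<le> real (Suc m) * k" for m
      using k by (simp_all add: mult_right_mono)
    have U_Suc: "U (Suc m) \<omega> = S k (w m \<omega>)" for m \<omega>
      unfolding U_def w_def D_def by (rule exponential_integrator_Suc_unitary[where S = S, OF unitary])
    have sub: "subalgebra M (F (real m * k))" for m
      using assms(5) times(1)[of m] by (simp add: normal_filtration_def)
    have D: "D m \<in> borel_measurable M" for m
      unfolding D_def using increment_measurable[OF times] .
    have embed: "weakly_measurable (F (real (Suc m) * k)) X" if "weakly_measurable (F (real m * k)) X"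
      for m and X :: "'w \<Rightarrow> 'd L2"
    proof (rule weakly_measurable_mono[OF that])
      show "sets (F (real m * k)) \<subseteq> sets (F (real (Suc m) * k))"
        using assms(5) times[of m] unfolding normal_filtration_def by blast
      show "space (F (real m * k)) = space (F (real (Suc m) * k))"
        using sub[of m] sub[of "Suc m"] by (simp add: subalgebra_def)
    qed
    have W_adapted: "weakly_measurable (F (real m * k)) (W (real m * k))" for m
      using W times(1)[of m] by (blast intro: weakly_measurable_if_borel)
    have D_adapted: "weakly_measurable (F (real (Suc m) * k)) (D m)" for m
      unfolding D_def by (intro weakly_measurable_diff embed W_adapted)
    have gauss: "centred_gaussian (distr M borel (D m)) R" for m
    proof -
      have "real (Suc m) * k - real m * k = k"
        by (simp add: algebra_simps)
      then show ?thesis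
        using W times[of m] unfolding D_def R_def by metis
    qed
    have indep: "indep_set (sets (F (real m * k))) (sets (vimage_algebra (space M) (D m) borel))" for m
      using W times[of m] unfolding D_def by metis
    have nonneg: "0 \<le> inner (R v) v" for v
      using k by (simp add: R_def Q)
    have trace: "summable (\<lambda>j. inner (R (e j)) (e j))" "(\<Sum>j. inner (R (e j)) (e j)) = k * \<tau>"
      using assms(9) by (simp_all add: R_def Q \<tau>_def summable_mult suminf_mult)
    have U: "weakly_measurable (F (real m * k)) (U m) \<and> integrable M (\<lambda>\<omega>. (norm (U m \<omega>))\<^sup>2)" for m
    proof (induction m)
      case 0
      show ?case
        using assms(12,13) by (simp add: U_def weakly_measurable_if_borel flip: mass_eq_norm_square)
    next
      case (Suc m)
      have "weakly_measurable (F (real (Suc m) * k)) (U m)"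
        using Suc.IH embed by blast
      then have "weakly_measurable (F (real (Suc m) * k)) (w m)"
        unfolding w_def using B(2) assms(14) D_adapted[of m]
        by (intro weakly_measurable_diff weakly_measurable_scaleC weakly_measurable_mult_L2)
      then have "weakly_measurable (F (real (Suc m) * k)) (U (Suc m))"
        unfolding U_Suc by (rule weakly_measurable_unitary[OF unitary])
      moreover have "integrable M (\<lambda>\<omega>. (norm (U (Suc m) \<omega>))\<^sup>2)"
        unfolding U_Suc norm_S
        using integrator_step(1)[OF assms(8) sub _ _ D indep gauss nonneg trace(1) B(2,1) assms(14) w_def] Suc.IH
        by blast
      ultimately show ?case
        by simp
    qed
    note step = integrator_step(2,3)[OF assms(8) sub U[THEN conjunct1] U[THEN conjunct2] D indep gauss nonneg
        trace(1) B(2,1) assms(14) w_def]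
    define a where "a m = (\<integral>\<omega>. (norm (U m \<omega>))\<^sup>2 \<partial>M)" for m
    define b where "b m = (\<integral>\<omega>. (norm (mult_L2 V (U m \<omega>)))\<^sup>2 \<partial>M)" for m
    have "a (Suc m) = a m + k\<^sup>2 * b m + k * \<tau>" for m
      using step(2)[of m] by (simp add: a_def b_def U_Suc norm_S trace(2))
    moreover have "0 \<le> b m" "b m \<le> B\<^sup>2 * a m" for m
      using step(1)[of m] by (simp_all add: a_def b_def)
    moreover have "0 \<le> a 0"
      by (simp add: a_def)
    ultimately have "\<bar>a n - a 0 - real n * k * \<tau>\<bar> \<le> T * (B\<^sup>2 * (exp (T\<^sup>2 * B\<^sup>2) * (a 0 + T * \<tau>))) * k"
      using \<tau> k n by (intro perturbed_recursion_linear_growth[where b = b]) auto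
    then show ?thesis
      using U[of n] by (simp add: a_def mass_eq_norm_square U_def)
  qed
  show ?thesis
  proof (intro exI allI impI)
    fix N n :: nat
    assume "1 \<le> N" "real n * (T / real N) \<le> T"
    moreover have "0 \<le> T / real N" "T / real N \<le> T"
      using assms(2) \<open>1 \<le> N\<close> by (simp_all add: divide_le_eq)
    ultimately show "integrable M (\<lambda>\<omega>. mass (exponential_integrator S V W u\<^sub>0 (T / real N) n \<omega>)) \<and>
      \<bar>(\<integral>\<omega>. mass (exponential_integrator S V W u\<^sub>0 (T / real N) n \<omega>) \<partial>M) - (\<integral>\<omega>. mass (u\<^sub>0 \<omega>) \<partial>M)
        - real n * (T / real N) * (\<Sum>j. (norm (Qhalf (e j)))\<^sup>2)\<bar>
      \<le> (T * (B\<^sup>2 * (exp (T\<^sup>2 * B\<^sup>2) * ((\<integral>\<omega>. mass (u\<^sub>0 \<omega>) \<partial>M) + T * \<tau>)))) * (T / real N)"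
      using main unfolding \<tau>_def[symmetric] by blast
  qed
qed

end
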